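(* Let $1\le k<r$ be integers. There exists $n_0=n_0(k,r)$ such that for all $n\ge n_0$, $$\mathrm{ex}(n,K_k,B_{r,1})=\mathcal{N}(K_k,T^+(n,r-1)).$$
   Context: All graphs are finite and simple. A graph is $F$-free if it does not contain $F$ as a (not necessarily induced) subgraph. $\mathcal{N}(H,G)$ denotes the number of unlabeled copies of $H$ in $G$, i.e. the number of (not necessarily induced) subgraphs of $G$ isomorphic to $H$. $\mathrm{ex}(n,H,F)$ is the maximum of $\mathcal{N}(H,G)$ over all $n$-vertex $F$-free graphs $G$. $K_m$ is the complete graph on $m$ vertices. $B_{r,1}$ is the graph consisting of two $r$-cliques sharing exactly one vertex. $T(n,p)$ is the Turán graph: the complete $p$-partite graph on $n$ vertices with each part having order $\lfloor n/p\rfloor$ or $\lceil n/p\rceil$. $T^+(n,r-1)$ is the graph obtained from $T(n,r-1)$ by adding an edge inside a smallest part. *)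

theory Defs
  imports Complex_Main
begin

text \<open>A finite simple graph is a pair of a finite vertex set and a set of two-element
  subsets of it.\<close>

type_synonym 'a graph = "'a set \<times> 'a set set"

abbreviation verts :: "'a graph \<Rightarrow> 'a set" where
  "verts G \<equiv> fst G"

abbreviation edges :: "'a graph \<Rightarrow> 'a set set" where
  "edges G \<equiv> snd G"

definition simple_graph :: "'a graph \<Rightarrow> bool" where
  "simple_graph G \<longleftrightarrow> finite (verts G) \<and> (\<forall>e\<in>edges G. e \<subseteq> verts G \<and> card e = 2)"

definition subgraph :: "'a graph \<Rightarrow> 'a graph \<Rightarrow> bool" where
  "subgraph S G \<longleftrightarrow> simple_graph S \<and> verts S \<subseteq> verts G \<and> edges S \<subseteq> edges G"

definition isomorphic :: "'a graph \<Rightarrow> 'b graph \<Rightarrow> bool" where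
  "isomorphic G H \<longleftrightarrow> (\<exists>f. bij_betw f (verts G) (verts H) \<and>
     (\<forall>u\<in>verts G. \<forall>v\<in>verts G. {u, v} \<in> edges G \<longleftrightarrow> {f u, f v} \<in> edges H))"

definition copies :: "'a graph \<Rightarrow> 'b graph \<Rightarrow> 'b graph set" where
  "copies H G = {S. subgraph S G \<and> isomorphic H S}"

definition num_copies :: "'a graph \<Rightarrow> 'b graph \<Rightarrow> nat" where
  "num_copies H G = card (copies H G)"

definition free_of :: "'a graph \<Rightarrow> 'b graph \<Rightarrow> bool" where
  "free_of F G \<longleftrightarrow> \<not> (\<exists>S. subgraph S G \<and> isomorphic F S)"

text \<open>Every finite graph is isomorphic to one whose vertices are natural numbers, so it suffices
  to range over those. The lemmas \<open>finite_ex_values\<close> and \<open>ex_values_nonempty\<close> below show that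
  the maximum is a genuine one as soon as the forbidden graph has an edge.\<close>

definition ex_values :: "nat \<Rightarrow> 'a graph \<Rightarrow> 'b graph \<Rightarrow> nat set" where
  "ex_values n H F =
     {num_copies H G | G :: nat graph. simple_graph G \<and> card (verts G) = n \<and> free_of F G}"

definition ex_num :: "nat \<Rightarrow> 'a graph \<Rightarrow> 'b graph \<Rightarrow> nat" where
  "ex_num n H F = Max (ex_values n H F)"

definition complete_edges :: "'a set \<Rightarrow> 'a set set" where
  "complete_edges A = {e. e \<subseteq> A \<and> card e = 2}"

definition complete_graph :: "nat \<Rightarrow> nat graph" where
  "complete_graph m = ({..<m}, complete_edges {..<m})"

text \<open>The graph \<open>B\<^bsub>r,1\<^esub>\<close> (for \<open>r \<ge> 1\<close>): the cliques are \<open>{0..<r}\<close> and \<open>{r-1..<2r-1}\<close>, and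
  their common vertex is \<open>r - 1\<close>.\<close>

definition B1_graph :: "nat \<Rightarrow> nat graph" where
  "B1_graph r = ({..<2 * r - 1}, complete_edges {..<r} \<union> complete_edges {r - 1..<2 * r - 1})"

definition complete_multipartite :: "'a set \<Rightarrow> ('a \<Rightarrow> 'b) \<Rightarrow> 'a graph" where
  "complete_multipartite V part = (V, {{u, v} | u v. u \<in> V \<and> v \<in> V \<and> part u \<noteq> part v})"

text \<open>The parts of \<open>T(n,p)\<close> are the residue classes modulo \<open>p\<close>. By \<open>turan_part_balanced\<close> and
  \<open>turan_last_part_smallest\<close> below they have the prescribed orders, and the class of \<open>p - 1\<close>
  is a smallest one.\<close>

definition turan_part :: "nat \<Rightarrow> nat \<Rightarrow> nat \<Rightarrow> nat set" where
  "turan_part n p i = {v. v < n \<and> v mod p = i}"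

definition turan :: "nat \<Rightarrow> nat \<Rightarrow> nat graph" where
  "turan n p = complete_multipartite {..<n} (\<lambda>v. v mod p)"

text \<open>The added edge joins \<open>p - 1\<close> and \<open>2p - 1\<close>, the first two members of the residue class of
  \<open>p - 1\<close>. Both are vertices exactly if \<open>n \<ge> 2p\<close>, that is, if a smallest part has at least two
  vertices; for smaller \<open>n\<close> there is no graph \<open>T\<^sup>+(n,p)\<close>, and the value below is meaningless.\<close>

definition turan_plus :: "nat \<Rightarrow> nat \<Rightarrow> nat graph" where
  "turan_plus n p = (verts (turan n p), insert {p - 1, 2 * p - 1} (edges (turan n p)))"


lemma finite_subgraphs:
  assumes "simple_graph G"
  shows "{S. subgraph S G} \<subseteq> Pow (verts G) \<times> Pow (Pow (verts G))"
  using assms unfolding subgraph_def simple_graph_def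
  by (clarsimp simp: mem_Times_iff) blast

lemma finite_ex_values: "finite (ex_values n H F)"
proof -
  have "num_copies H G \<le> 2 ^ n * 2 ^ (2 ^ n)"
    if G: "simple_graph G" "card (verts G) = n" for G :: "nat graph"
  proof -
    have fin: "finite (verts G)" using G by (simp add: simple_graph_def)
    have "copies H G \<subseteq> Pow (verts G) \<times> Pow (Pow (verts G))"
      using finite_subgraphs[OF G(1)] by (auto simp: copies_def)
    then have "card (copies H G) \<le> card (Pow (verts G) \<times> Pow (Pow (verts G)))"
      using fin by (intro card_mono) auto
    also have "\<dots> = 2 ^ n * 2 ^ (2 ^ n)"
      using fin G by (simp add: card_cartesian_product card_Pow)
    finally show ?thesis by (simp add: num_copies_def)
  qed
  then have "ex_values n H F \<subseteq> {..2 ^ n * 2 ^ (2 ^ n)}"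
    by (auto simp: ex_values_def)
  then show ?thesis by (rule finite_subset) simp
qed

lemma ex_values_nonempty:
  assumes "simple_graph F" "edges F \<noteq> {}"
  shows "ex_values n H F \<noteq> {}"
proof -
  let ?G = "({..<n}, {}) :: nat graph"
  have "free_of F ?G"
    unfolding free_of_def
  proof (intro notI, elim exE conjE)
    fix S assume S: "subgraph S ?G" "isomorphic F S"
    obtain e where e: "e \<in> edges F" using assms by blast
    then have "card e = 2" "e \<subseteq> verts F" using assms by (auto simp: simple_graph_def)
    then obtain u v where "e = {u, v}" "u \<in> verts F" "v \<in> verts F"
      by (auto simp: card_2_iff)
    then show False using S e by (auto simp: isomorphic_def subgraph_def)
  qed
  then have "num_copies H ?G \<in> ex_values n H F"
    unfolding ex_values_def mem_Collect_eq
    by (intro exI[of _ ?G] conjI) (auto simp: simple_graph_def)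
  then show ?thesis by blast
qed

lemma card_turan_part:
  assumes "i < p"
  shows "card (turan_part n p i) = n div p + (if i < n mod p then 1 else 0)"
proof -
  have p: "p > 0" using assms by simp
  have "turan_part n p i = (\<lambda>q. q * p + i) ` {..<n div p + (if i < n mod p then 1 else 0)}"
  proof (intro equalityI subsetI)
    fix v assume "v \<in> turan_part n p i"
    then have v: "v < n" "v mod p = i" by (auto simp: turan_part_def)
    have eq: "v = (v div p) * p + i" using v by (metis div_mult_mod_eq)
    have le: "v div p \<le> n div p" using v by (simp add: div_le_mono)
    have "i < n mod p" if "v div p = n div p"
      using that v(1) eq div_mult_mod_eq[of n p] by (metis nat_add_left_cancel_less)
    then have "v div p < n div p + (if i < n mod p then 1 else 0)"
      using le by (cases "v div p = n div p") auto
    then show "v \<in> (\<lambda>q. q * p + i) ` {..<n div p + (if i < n mod p then 1 else 0)}"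
      using eq by blast
  next
    fix v assume "v \<in> (\<lambda>q. q * p + i) ` {..<n div p + (if i < n mod p then 1 else 0)}"
    then obtain q where q: "q < n div p + (if i < n mod p then 1 else 0)" "v = q * p + i"
      by auto
    have n: "n = n div p * p + n mod p" by simp
    have "v < n"
    proof (cases "q < n div p")
      case True
      then have "Suc q * p \<le> n div p * p" by (intro mult_le_mono1) simp
      then have "Suc q * p \<le> n" using n by linarith
      then show ?thesis using q(2) assms by simp
    next
      case False
      then have "q = n div p" "i < n mod p" using q(1) by (auto split: if_splits)
      then show ?thesis using q(2) n by (metis nat_add_left_cancel_less)
    qed
    then show "v \<in> turan_part n p i" using q assms by (simp add: turan_part_def)
  qed
  moreover have "inj_on (\<lambda>q. q * p + i) A" for A using p by (auto simp: inj_on_def)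
  ultimately show ?thesis by (simp add: card_image)
qed

lemma turan_part_balanced:
  assumes "i < p"
  shows "int (card (turan_part n p i)) \<in> {\<lfloor>real n / real p\<rfloor>, \<lceil>real n / real p\<rceil>}"
proof (cases "i < n mod p")
  case False
  then show ?thesis using card_turan_part[OF assms, of n] by (simp add: floor_divide_of_nat_eq)
next
  case True
  then have "\<not> p dvd n" by (auto simp: dvd_eq_mod_eq_0)
  have p: "0 < real p" using assms by simp
  have n: "real n = real (n div p) * real p + real (n mod p)"
    by (metis div_mult_mod_eq of_nat_add of_nat_mult)
  have "n mod p \<le> p" using assms by (simp add: less_imp_le)
  then have "real n \<le> real (n div p) * real p + real p" using n by simp
  moreover have "real (n div p) * real p < real n" using n True by simp
  ultimately have "\<lceil>real n / real p\<rceil> = int (n div p) + 1"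
    using p by (intro ceiling_unique) (auto simp: field_simps)
  then show ?thesis using True card_turan_part[OF assms, of n] by simp
qed

lemma turan_last_part_smallest:
  assumes "i < p"
  shows "card (turan_part n p (p - 1)) \<le> card (turan_part n p i)"
proof -
  have "n mod p < p" using assms by simp
  then show ?thesis using assms card_turan_part[of "p - 1" p n] card_turan_part[of i p n] by auto
qed

lemma turan_plus_edge:
  assumes "p \<ge> 1" "n \<ge> 2 * p"
  shows "{p - 1, 2 * p - 1} \<subseteq> turan_part n p (p - 1)" "p - 1 \<noteq> 2 * p - 1"
proof -
  have "2 * p - 1 = (p - 1) + p" using assms by simp
  then have "(2 * p - 1) mod p = p - 1" using assms
    by (metis mod_add_self2 mod_less diff_less zero_less_one less_le_trans)
  then show "{p - 1, 2 * p - 1} \<subseteq> turan_part n p (p - 1)" using assms by (auto simp: turan_part_def)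
qed (use assms in simp)

lemma simple_graph_turan_plus:
  assumes "p \<ge> 1" "n \<ge> 2 * p"
  shows "simple_graph (turan_plus n p)"
  using turan_plus_edge[OF assms]
  by (auto simp: simple_graph_def turan_plus_def turan_def complete_multipartite_def
      turan_part_def card_2_iff)

end

theory Submission
  imports Defs "HOL-Computational_Algebra.Polynomial" "HOL-Analysis.Convex"
begin

text \<open>Put \<open>p = r - 1\<close>. The case \<open>k = 1\<close> counts vertices, so let \<open>2 \<le> k \<le> p\<close>, and call a graph bowtie-free if
no two of its \<open>(p + 1)\<close>-cliques meet in exactly one vertex. In \<open>T\<^sup>+(n,p)\<close> every \<open>(p + 1)\<close>-clique contains
both ends of the added edge, so this graph is bowtie-free; the work is in the upper bound.

Bowtie-freeness is very restrictive at each single vertex: all \<open>(p + 1)\<close>-cliques through a vertex \<open>v\<close>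
meet any fixed one of them in a second vertex, so deleting
the at most \<open>p\<close> edges from \<open>v\<close> to that fixed clique destroys all of them. Hence \<open>O(n)\<close> deletions leave a
\<open>K\<^bsub>p+1\<^esub>\<close>-free graph, and only \<open>O(n\<^bsup>k-1\<^esup>)\<close> \<open>k\<close>-cliques are lost (\<open>bowtie_free_clique_deletion\<close>). If there were
nearly as many \<open>k\<close>-cliques as in the Turan graph, the Moon--Moser inequalities turn this into nearly as many
edges as in the Turan graph (\<open>clique_count_le\<close>, \<open>clique_rich_many_edges\<close>), and Fueredi's short argument
(\<open>Fueredi_stability\<close>) then yields a \<open>p\<close>-partition missing few cross edges, which may be taken to be a
maximum cut (\<open>clique_rich_max_cut\<close>).

The locale \<open>near_turan\<close> analyses a graph with such a cut. Almost all vertices are typical, that is, miss few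
cross edges, so cliques can be built greedily from typical vertices (\<open>greedy_clique\<close>). By the maximality of the
cut, a vertex with many neighbours in its own part has many in every part and is the centre of a bowtie; so
all vertices have small inner degree (\<open>inner_degree\<close>). Therefore a vertex that misses a positive fraction of the
cross edges lies in substantially fewer \<open>k\<close>-cliques than a vertex of the Turan graph (\<open>exceptional_degree\<close>).
Among the other vertices, two edges inside parts almost always extend to a bowtie (\<open>two_inner_edges\<close>): there is
at most one such edge, except that for \<open>p = 2\<close> there may be one per part at the price of a missing cross edge.
So these vertices span at most as many \<open>k\<close>-cliques as a complete \<open>p\<close>-partite graph plus one edge
(\<open>ordinary_clique_count\<close>). Balancing the parts shows that the optimum of that configuration is \<open>T\<^sup>+\<close>
(\<open>edge_value_le_turan\<close>), and adding the exceptional vertices back one at a time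
gains no more cliques than \<open>T\<^sup>+\<close> gains when its order grows by one (\<open>clique_count_le_turan_plus\<close>).\<close>

section \<open>Cliques and the Moon--Moser inequality\<close>

definition cliques :: "('a \<Rightarrow> 'a \<Rightarrow> bool) \<Rightarrow> 'a set \<Rightarrow> nat \<Rightarrow> 'a set set" where
  "cliques E V m = {S. S \<subseteq> V \<and> card S = m \<and> (\<forall>u\<in>S. \<forall>v\<in>S. u \<noteq> v \<longrightarrow> E u v)}"

lemma finite_cliques: "finite V \<Longrightarrow> finite (cliques E V m)"
  by (rule finite_subset[of _ "Pow V"]) (auto simp: cliques_def)

lemma cliques_mono:
  "\<lbrakk>U \<subseteq> V; \<And>u v. \<lbrakk>u \<in> U; v \<in> U; u \<noteq> v; E u v\<rbrakk> \<Longrightarrow> E' u v\<rbrakk> \<Longrightarrow> cliques E U m \<subseteq> cliques E' V m"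
  by (auto simp: cliques_def subset_iff)

lemma card_cliques_0: "finite V \<Longrightarrow> card (cliques E V 0) = 1"
proof -
  assume "finite V"
  then have "cliques E V 0 = {{}}" by (auto simp: cliques_def dest: finite_subset)
  then show ?thesis by simp
qed

lemma card_cliques_1: "finite V \<Longrightarrow> card (cliques E V 1) = card V"
proof -
  assume "finite V"
  have "cliques E V 1 = (\<lambda>v. {v}) ` V" by (auto simp: cliques_def card_1_singleton_iff)
  then show ?thesis by (simp add: card_image inj_on_def)
qed

lemma card_subsets_le_power:
  assumes "finite V"
  shows "card {S. S \<subseteq> V \<and> card S = m} \<le> card V ^ m"
proof -
  have "card {S. S \<subseteq> V \<and> card S = m} = card V choose m" by (rule n_subsets[OF assms])
  also have "\<dots> \<le> card V ^ m" by (cases "m \<le> card V") (auto simp: binomial_le_pow binomial_eq_0)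
  finally show ?thesis .
qed

lemma card_supersets_le:
  assumes "finite V" "finite C" "card C = c"
  shows "card {S. S \<subseteq> V \<and> card S = m \<and> C \<subseteq> S} \<le> card V ^ (m - c)"
proof -
  let ?A = "{S. S \<subseteq> V \<and> card S = m \<and> C \<subseteq> S}"
  have "inj_on (\<lambda>S. S - C) ?A" by (intro inj_onI) blast
  moreover have "(\<lambda>S. S - C) ` ?A \<subseteq> {S. S \<subseteq> V \<and> card S = m - c}"
    using assms by (auto simp: card_Diff_subset)
  ultimately have "card ?A \<le> card {S. S \<subseteq> V \<and> card S = m - c}"
    using assms(1) by (intro card_inj_on_le[of "\<lambda>S. S - C"]) auto
  then show ?thesis using card_subsets_le_power[OF assms(1)] le_trans by blast
qed

lemma card_sets_with_pair_le:
  assumes "finite V" "D \<subseteq> V \<times> V"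
  shows "card {S. S \<subseteq> V \<and> card S = m \<and> (\<exists>(u, v)\<in>D. u \<noteq> v \<and> u \<in> S \<and> v \<in> S)} \<le> card D * card V ^ (m - 2)"
proof -
  have fD: "finite D" using assms finite_subset by blast
  let ?A = "\<lambda>(u, v). {S. S \<subseteq> V \<and> card S = m \<and> u \<noteq> v \<and> {u, v} \<subseteq> S}"
  have "card (?A d) \<le> card V ^ (m - 2)" for d
  proof (cases "fst d = snd d")
    case False
    then have "card {fst d, snd d} = 2" by simp
    then have "card {S. S \<subseteq> V \<and> card S = m \<and> {fst d, snd d} \<subseteq> S} \<le> card V ^ (m - 2)"
      by (intro card_supersets_le[OF assms(1)]) auto
    then show ?thesis using False by (simp add: case_prod_beta)
  qed (simp add: case_prod_beta)
  then have "card (\<Union>(?A ` D)) \<le> card D * card V ^ (m - 2)"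
    using card_UN_le[OF fD, of ?A] sum_bounded_above[of D "\<lambda>d. card (?A d)" "card V ^ (m - 2)"]
    by auto
  moreover have "{S. S \<subseteq> V \<and> card S = m \<and> (\<exists>(u, v)\<in>D. u \<noteq> v \<and> u \<in> S \<and> v \<in> S)} = \<Union>(?A ` D)"
    by auto
  ultimately show ?thesis by simp
qed

text \<open>The vertices that enlarge the clique \<open>B\<close> to a clique with one more vertex; their number is the degree of \<open>B\<close>
in the sense of Moon and Moser.\<close>

definition extenders :: "('a \<Rightarrow> 'a \<Rightarrow> bool) \<Rightarrow> 'a set \<Rightarrow> 'a set \<Rightarrow> 'a set" where
  "extenders E V B = {v \<in> V. v \<notin> B \<and> insert v B \<in> cliques E V (Suc (card B))}"

text \<open>A pair consisting of a clique and a vertex extending it is the same thing as a larger clique with a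
distinguished vertex. All double counts below are instances of this.\<close>

lemma sum_clique_extensions:
  fixes f :: "'a set \<Rightarrow> 'a \<Rightarrow> nat"
  assumes fin: "finite V"
  shows "(\<Sum>B\<in>cliques E V m. \<Sum>v\<in>extenders E V B. f B v) = (\<Sum>A\<in>cliques E V (Suc m). \<Sum>v\<in>A. f (A - {v}) v)"
proof -
  have finS: "finite S" if "S \<in> cliques E V i" for S i
    using that fin by (auto simp: cliques_def dest: finite_subset)
  have "(\<Sum>B\<in>cliques E V m. \<Sum>v\<in>extenders E V B. f B v)
      = (\<Sum>(B, v)\<in>Sigma (cliques E V m) (extenders E V). f B v)"
    using fin by (intro sum.Sigma) (auto simp: finite_cliques extenders_def)
  also have "\<dots> = (\<Sum>(A, v)\<in>Sigma (cliques E V (Suc m)) id. f (A - {v}) v)"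
  proof (rule sum.reindex_bij_witness[where i = "\<lambda>(A, v). (A - {v}, v)" and j = "\<lambda>(B, v). (insert v B, v)"])
    fix x assume x: "x \<in> Sigma (cliques E V (Suc m)) id"
    obtain A v where [simp]: "x = (A, v)" by (cases x)
    have v: "A \<in> cliques E V (Suc m)" "v \<in> A" using x by auto
    have 1: "A - {v} \<in> cliques E V m"
      using v finS[OF v(1)] by (auto simp: cliques_def)
    have "v \<in> extenders E V (A - {v})" using v finS[OF v(1)] 
      by (auto simp: extenders_def cliques_def insert_absorb)
    then show "(case x of (A, v) \<Rightarrow> (A - {v}, v)) \<in> Sigma (cliques E V m) (extenders E V)"
      using 1 by simp
    show "(case case x of (A, v) \<Rightarrow> (A - {v}, v) of (B, v) \<Rightarrow> (insert v B, v)) = x"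
      using v by auto
  qed (auto simp: extenders_def cliques_def)
  also have "\<dots> = (\<Sum>A\<in>cliques E V (Suc m). \<Sum>v\<in>id A. f (A - {v}) v)"
    using fin by (intro sum.Sigma[symmetric]) (auto simp: finite_cliques intro: finS)
  finally show ?thesis by simp
qed

lemma sum_card_extenders:
  assumes "finite V"
  shows "(\<Sum>B\<in>cliques E V m. card (extenders E V B)) = Suc m * card (cliques E V (Suc m))"
proof -
  have "(\<Sum>B\<in>cliques E V m. card (extenders E V B)) = (\<Sum>A\<in>cliques E V (Suc m). \<Sum>v\<in>A. 1)"
    using sum_clique_extensions[OF assms, of "\<lambda>_ _. 1"] by simp
  also have "\<dots> = (\<Sum>A\<in>cliques E V (Suc m). Suc m)"
    by (intro sum.cong) (auto simp: cliques_def)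
  finally show ?thesis by simp
qed

text \<open>The sum counts triples of a clique \<open>A\<close> with \<open>m + 1\<close> vertices, a vertex \<open>u\<close> in it and a vertex \<open>v\<close> extending
\<open>A - {u}\<close>. For fixed \<open>A\<close> and \<open>v\<close> there is at most one such \<open>u\<close> unless \<open>v\<close> is adjacent to all of \<open>A\<close>: if
both \<open>A - {u}\<close> and \<open>A - {u'}\<close> are joined to \<open>v\<close>, so is their union \<open>A\<close>.\<close>

lemma sum_extenders_squared_le:
  assumes fin: "finite V" and sym: "\<And>u v. E u v \<longleftrightarrow> E v u"
  shows "(\<Sum>B\<in>cliques E V m. card (extenders E V B) ^ 2)
    \<le> card V * card (cliques E V (Suc m)) + m * (m + 2) * card (cliques E V (m + 2))"
proof -
  have *: "(\<Sum>u\<in>A. card (extenders E V (A - {u}))) \<le> card V + m * card (extenders E V A)"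
    if A: "A \<in> cliques E V (Suc m)" for A
  proof -
    have fA: "finite A" "card A = Suc m" "A \<subseteq> V" using A fin by (auto simp: cliques_def dest: finite_subset)
    have cl: "E x y" if "x \<in> A" "y \<in> A" "x \<noteq> y" for x y using A that by (auto simp: cliques_def)
    have "(\<Sum>u\<in>A. card (extenders E V (A - {u}))) = (\<Sum>u\<in>A. \<Sum>v\<in>V. if v \<in> extenders E V (A - {u}) then 1 else 0)"
      using fin by (intro sum.cong) (auto simp: extenders_def sum.If_cases Int_def)
    also have "\<dots> = (\<Sum>v\<in>V. \<Sum>u\<in>A. if v \<in> extenders E V (A - {u}) then 1 else 0)"
      by (rule sum.swap)
    also have "\<dots> = (\<Sum>v\<in>V. card {u \<in> A. v \<in> extenders E V (A - {u})})"
      using fA by (intro sum.cong) (auto simp: sum.If_cases Int_def)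
    also have "\<dots> \<le> (\<Sum>v\<in>V. 1 + (if v \<in> extenders E V A then m else 0))"
    proof (intro sum_mono)
      fix v assume v: "v \<in> V"
      show "card {u \<in> A. v \<in> extenders E V (A - {u})} \<le> 1 + (if v \<in> extenders E V A then m else 0)"
      proof (cases "v \<in> extenders E V A")
        case True
        then show ?thesis using fA card_mono[of A "{u \<in> A. v \<in> extenders E V (A - {u})}"] by auto
      next
        case False
        have "u = u'" if u: "u \<in> A" "u' \<in> A" "v \<in> extenders E V (A - {u})" "v \<in> extenders E V (A - {u'})" for u u'
        proof (rule ccontr)
          assume ne: "u \<noteq> u'"
          have "v \<notin> A" using u ne by (auto simp: extenders_def)
          have "E v x" if "x \<in> A" for x
          proof (cases "x = u")
            case True
            then have "x \<in> A - {u'}" using that ne by auto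
            then show ?thesis using u(4) \<open>v \<notin> A\<close> that by (auto simp: extenders_def cliques_def)
          next
            case False
            then have "x \<in> A - {u}" using that by auto
            then show ?thesis using u(3) \<open>v \<notin> A\<close> that by (auto simp: extenders_def cliques_def)
          qed
          then have "v \<in> extenders E V A" using v \<open>v \<notin> A\<close> fA cl sym by (auto simp: extenders_def cliques_def)
          then show False using False by simp
        qed
        then have "card {u \<in> A. v \<in> extenders E V (A - {u})} \<le> Suc 0"
          by (subst card_le_Suc0_iff_eq) (use fA in auto)
        then show ?thesis by simp
      qed
    qed
    also have "\<dots> = card V + m * card (extenders E V A)"
    proof -
      have "V \<inter> {v. v \<in> extenders E V A} = extenders E V A" by (auto simp: extenders_def)
      then show ?thesis using fin by (simp only: sum.distrib) (simp add: sum.If_cases)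
    qed
    finally show ?thesis .
  qed
  have "(\<Sum>B\<in>cliques E V m. card (extenders E V B) ^ 2) = (\<Sum>B\<in>cliques E V m. \<Sum>v\<in>extenders E V B. card (extenders E V B))"
    by (simp add: power2_eq_square)
  also have "\<dots> = (\<Sum>A\<in>cliques E V (Suc m). \<Sum>u\<in>A. card (extenders E V (A - {u})))"
    by (rule sum_clique_extensions[OF fin])
  also have "\<dots> \<le> (\<Sum>A\<in>cliques E V (Suc m). card V + m * card (extenders E V A))"
    by (intro sum_mono *)
  also have "\<dots> = card V * card (cliques E V (Suc m)) + m * (m + 2) * card (cliques E V (m + 2))"
    using sum_card_extenders[OF fin, of E "Suc m"]
    by (simp add: sum.distrib algebra_simps flip: sum_distrib_left)
  finally show ?thesis .
qed

text \<open>Cauchy--Schwarz applied to the degrees of the cliques with \<open>m\<close> vertices.\<close>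

theorem Moon_Moser:
  assumes "finite V" and "\<And>u v. E u v \<longleftrightarrow> E v u"
  shows "(Suc m * card (cliques E V (Suc m)))\<^sup>2 \<le> card (cliques E V m) *
    (card V * card (cliques E V (Suc m)) + m * (m + 2) * card (cliques E V (m + 2)))"
proof -
  have "(\<Sum>B\<in>cliques E V m. card (extenders E V B))\<^sup>2 \<le> (\<Sum>B\<in>cliques E V m. (card (extenders E V B))\<^sup>2) * card (cliques E V m)"
  proof -
    have "(\<Sum>B\<in>cliques E V m. real (card (extenders E V B)))\<^sup>2 \<le> (\<Sum>B\<in>cliques E V m. (real (card (extenders E V B)))\<^sup>2) * card (cliques E V m)"
      by (rule sum_squared_le_sum_of_squares)
    then have "real ((\<Sum>B\<in>cliques E V m. card (extenders E V B))\<^sup>2) \<le> real ((\<Sum>B\<in>cliques E V m. (card (extenders E V B))\<^sup>2) * card (cliques E V m))"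
      by simp
    then show ?thesis by (simp only: of_nat_le_iff)
  qed
  also have "\<dots> \<le> (card V * card (cliques E V (Suc m)) + m * (m + 2) * card (cliques E V (m + 2))) * card (cliques E V m)"
    by (rule mult_le_mono1, rule sum_extenders_squared_le[OF assms])
  finally show ?thesis by (simp only: sum_card_extenders[OF assms(1)] mult.commute)
qed

text \<open>The Moon--Moser inequality bounds the ratio of consecutive clique numbers by the next ratio. In a
\<open>K\<^bsub>p+1\<^esub>\<close>-free graph the ratio at \<open>p\<close> is zero, and descending from there gives at every level
the ratio of the complete \<open>p\<close>-partite graph with equal parts.\<close>

lemma clique_ratio_le:
  assumes fin: "finite V" and sym: "\<And>u v. E u v \<longleftrightarrow> E v u" and free: "cliques E V (Suc p) = {}" and "s \<le> p"
  shows "real p * (s + 1) * card (cliques E V (s + 1)) \<le> real (p - s) * card V * card (cliques E V s)"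
  using \<open>s \<le> p\<close>
proof (induction s rule: inc_induct)
  case base
  then show ?case using free by simp
next
  case (step s)
  define a b c n where "a = real (card (cliques E V s))" and "b = real (card (cliques E V (s + 1)))"
    and "c = real (card (cliques E V (s + 2)))" and "n = real (card V)"
  have MM: "((s + 1) * b)^2 \<le> a * (n * b + s * (s + 2) * c)"
  proof -
    have "real ((Suc s * card (cliques E V (Suc s)))\<^sup>2) \<le> real (card (cliques E V s) *
      (card V * card (cliques E V (Suc s)) + s * (s + 2) * card (cliques E V (s + 2))))"
      by (subst of_nat_le_iff) (rule Moon_Moser[OF fin sym])
    then show ?thesis by (simp add: a_def b_def c_def n_def algebra_simps)
  qed
  have IH: "p * (s + 2) * c \<le> (real p - s - 1) * n * b"
    using step by (simp add: b_def c_def n_def of_nat_diff algebra_simps)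
  have nn: "a \<ge> 0" "b \<ge> 0" "c \<ge> 0" "n \<ge> 0" by (simp_all add: a_def b_def c_def n_def)
  have "p * (s + 1) * b \<le> (real p - s) * n * a"
  proof (cases "b = 0")
    case True
    then show ?thesis using nn step by simp
  next
    case False
    have "p * ((s + 1) * b)^2 \<le> p * (a * (n * b + s * (s + 2) * c))"
      using MM by (intro mult_left_mono) auto
    also have "\<dots> = a * p * n * b + a * s * (p * (s + 2) * c)" by (simp add: algebra_simps)
    also have "\<dots> \<le> a * p * n * b + a * s * ((real p - s - 1) * n * b)"
      using IH nn by (intro add_left_mono mult_left_mono) auto
    also have "\<dots> = (s + 1) * b * ((real p - s) * n * a)" by (simp add: algebra_simps)
    finally have "((s + 1) * b) * (p * (s + 1) * b) \<le> ((s + 1) * b) * ((real p - s) * n * a)"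
      by (simp add: power2_eq_square algebra_simps)
    moreover have "(s + 1) * b > 0" using False nn by simp
    ultimately show ?thesis by (simp only: mult_le_cancel_left_pos)
  qed
  then show ?case using step by (simp add: a_def b_def n_def of_nat_diff algebra_simps)
qed

text \<open>The product of consecutive ratios. It serves in two ways: \<open>j = 2\<close> converts many cliques into many edges, and
\<open>j = 0\<close> is Zykov's upper bound for clique numbers in terms of the order alone.\<close>

lemma clique_count_le:
  assumes fin: "finite V" and sym: "\<And>u v. E u v \<longleftrightarrow> E v u" and free: "cliques E V (Suc p) = {}"
    and "0 < p" and "j + i \<le> p"
  shows "real (p choose j) * card (cliques E V (j + i)) \<le> real (p choose (j + i)) * (card V / p) ^ i * card (cliques E V j)"
  using \<open>j + i \<le> p\<close>
proof (induction i)
  case (Suc i)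
  let ?s = "j + i"
  define N where "N = (\<lambda>i. real (card (cliques E V i)))"
  define x where "x = card V / real p"
  have ch: "(p - ?s) * (p choose ?s) = Suc ?s * (p choose Suc ?s)"
    by (metis binomial_absorb_comp binomial_absorption)
  have ch': "real (p - ?s) * (p choose ?s) = real (Suc ?s) * (p choose Suc ?s)"
    using arg_cong[OF ch, of real] by (simp only: of_nat_mult)
  have r: "real (Suc ?s) * N (Suc ?s) \<le> real (p - ?s) * x * N ?s"
    using clique_ratio_le[OF fin sym free, of ?s] Suc.prems \<open>0 < p\<close> by (simp add: N_def x_def field_simps)
  have "real (Suc ?s) * (real (p choose j) * N (Suc ?s)) = real (p choose j) * (real (Suc ?s) * N (Suc ?s))"
    by (simp only: mult.left_commute)
  also have "\<dots> \<le> real (p choose j) * (real (p - ?s) * x * N ?s)"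
    by (rule mult_left_mono[OF r]) simp
  also have "\<dots> = real (p - ?s) * x * (real (p choose j) * N ?s)" by (simp only: mult_ac)
  also have "\<dots> \<le> real (p - ?s) * x * (real (p choose ?s) * x ^ i * N j)"
  proof (rule mult_left_mono)
    show "real (p choose j) * N ?s \<le> real (p choose ?s) * x ^ i * N j"
      using Suc by (simp add: N_def x_def)
  qed (simp add: x_def)
  also have "\<dots> = (real (p - ?s) * (p choose ?s)) * (x ^ Suc i * N j)" by simp
  also have "\<dots> = real (Suc ?s) * (real (p choose Suc ?s) * x ^ Suc i * N j)"
    unfolding ch' by (simp only: mult_ac)
  finally have "real (p choose j) * N (Suc ?s) \<le> real (p choose Suc ?s) * x ^ Suc i * N j"
    by (rule mult_left_le_imp_le) simp
  then show ?case unfolding N_def x_def by (simp only: add_Suc_right)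
qed simp

section \<open>Stability: maximum cuts with few missing edges\<close>

text \<open>Edge-like quantities are counted as ordered pairs, so that an edge inside a set counts twice and no
distinction between the two ends is needed.\<close>

definition npairs :: "('a \<Rightarrow> 'a \<Rightarrow> bool) \<Rightarrow> 'a set \<Rightarrow> 'a set \<Rightarrow> nat" where
  "npairs P A B = (\<Sum>u\<in>A. card {v \<in> B. P u v})"

lemma npairs_Un_left:
  "\<lbrakk>finite A; finite A'; A \<inter> A' = {}\<rbrakk> \<Longrightarrow> npairs P (A \<union> A') B = npairs P A B + npairs P A' B"
  by (simp add: npairs_def sum.union_disjoint)

lemma npairs_Un_right:
  assumes "finite B" "finite B'" "B \<inter> B' = {}"
  shows "npairs P A (B \<union> B') = npairs P A B + npairs P A B'"
proof -
  have "card {v \<in> B \<union> B'. P u v} = card {v \<in> B. P u v} + card {v \<in> B'. P u v}" for u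
  proof -
    have "{v \<in> B \<union> B'. P u v} = {v \<in> B. P u v} \<union> {v \<in> B'. P u v}" by auto
    then show ?thesis using assms by (simp add: card_Un_disjoint disjoint_iff)
  qed
  then show ?thesis by (simp add: npairs_def sum.distrib)
qed

lemma npairs_eq_card: "\<lbrakk>finite A; finite B\<rbrakk> \<Longrightarrow> npairs P A B = card {(u, v). u \<in> A \<and> v \<in> B \<and> P u v}"
proof -
  assume fin: "finite A" "finite B"
  have "{(u, v). u \<in> A \<and> v \<in> B \<and> P u v} = Sigma A (\<lambda>u. {v \<in> B. P u v})" by auto
  then show ?thesis using fin by (simp add: npairs_def)
qed

lemma npairs_swap:
  assumes "finite A" "finite B" "\<And>u v. P u v \<longleftrightarrow> P v u"
  shows "npairs P A B = npairs P B A"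
proof -
  have "{(u, v). u \<in> A \<and> v \<in> B \<and> P u v} = prod.swap ` {(u, v). u \<in> B \<and> v \<in> A \<and> P u v}"
    using assms(3) by auto
  then show ?thesis using assms by (simp add: npairs_eq_card card_image)
qed

lemma npairs_mono: "\<lbrakk>finite A; finite B; \<And>u v. \<lbrakk>u \<in> A; v \<in> B; P u v\<rbrakk> \<Longrightarrow> Q u v\<rbrakk> \<Longrightarrow> npairs P A B \<le> npairs Q A B"
  unfolding npairs_def by (intro sum_mono card_mono) auto

lemma npairs_cong: "\<lbrakk>\<And>u v. \<lbrakk>u \<in> A; v \<in> B\<rbrakk> \<Longrightarrow> P u v = Q u v\<rbrakk> \<Longrightarrow> npairs P A B = npairs Q A B"
  unfolding npairs_def by (intro sum.cong refl arg_cong[of _ _ card]) auto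

lemma npairs_eq_0: "\<lbrakk>\<And>u v. \<lbrakk>u \<in> A; v \<in> B\<rbrakk> \<Longrightarrow> \<not> P u v\<rbrakk> \<Longrightarrow> npairs P A B = 0"
proof -
  assume *: "\<And>u v. \<lbrakk>u \<in> A; v \<in> B\<rbrakk> \<Longrightarrow> \<not> P u v"
  have "npairs P A B = npairs (\<lambda>_ _. False) A B" by (rule npairs_cong) (use * in blast)
  then show ?thesis by (simp add: npairs_def)
qed

lemma npairs_disj:
  assumes "finite A" "finite B" "\<And>u v. \<not> (P u v \<and> Q u v)"
  shows "npairs (\<lambda>u v. P u v \<or> Q u v) A B = npairs P A B + npairs Q A B"
proof -
  have "card {v \<in> B. P u v \<or> Q u v} = card {v \<in> B. P u v} + card {v \<in> B. Q u v}" for u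
  proof -
    have "{v \<in> B. P u v \<or> Q u v} = {v \<in> B. P u v} \<union> {v \<in> B. Q u v}" by auto
    then show ?thesis using assms by (simp add: card_Un_disjoint disjoint_iff)
  qed
  then show ?thesis by (simp add: npairs_def sum.distrib)
qed

lemma npairs_split:
  assumes "finite A" "finite B"
  shows "npairs P A B = npairs (\<lambda>u v. P u v \<and> Q u v) A B + npairs (\<lambda>u v. P u v \<and> \<not> Q u v) A B"
  by (subst npairs_disj[symmetric]) (use assms in \<open>auto intro: npairs_cong\<close>)

lemma npairs_square_Un:
  assumes "finite N" "finite M" "N \<inter> M = {}" "\<And>u v. P u v \<longleftrightarrow> P v u"
  shows "npairs P (N \<union> M) (N \<union> M) = npairs P N N + 2 * npairs P M N + npairs P M M"
  using assms npairs_swap[of N M P]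
  by (simp add: npairs_Un_left npairs_Un_right)

text \<open>Fueredi's proof: split off, as one part, the complement \<open>M\<close> of the neighbourhood \<open>N\<close> of a vertex of maximum
degree. The degrees of the vertices of \<open>M\<close> sum to at most \<open>card M * card N\<close>, and this sum counts
the edges inside \<open>M\<close> twice but those between \<open>M\<close> and \<open>N\<close> once; the neighbourhood itself is
\<open>K\<^bsub>p\<^esub>\<close>-free, so induction applies to it.\<close>

theorem Fueredi_stability:
  assumes "finite V" and sym: "\<And>u v. E u v \<longleftrightarrow> E v u" and irr: "\<And>u. \<not> E u u"
    and "cliques E V (Suc p) = {}"
  shows "\<exists>g. g ` V \<subseteq> {..<p} \<and>
    npairs E V V + npairs (\<lambda>u v. E u v \<and> g u = g v) V V \<le> npairs (\<lambda>u v. g u \<noteq> g v) V V"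
  using assms(1,4)
proof (induction p arbitrary: V)
  case 0
  have "V = {}"
  proof (rule ccontr)
    assume "V \<noteq> {}"
    then obtain v where "v \<in> V" by blast
    then have "{v} \<in> cliques E V (Suc 0)" by (auto simp: cliques_def)
    then show False using 0 by simp
  qed
  then show ?case by (simp add: npairs_def)
next
  case (Suc p)
  note fin = \<open>finite V\<close>
  show ?case
  proof (cases "V = {}")
    case True
    then show ?thesis by (simp add: npairs_def)
  next
    case False
    define d where "d v = card {u \<in> V. E v u}" for v
    have "\<exists>x. x \<in> V \<and> (\<forall>y. y \<in> V \<longrightarrow> d y \<le> d x)"
    proof -
      obtain v where "v \<in> V" using False by blast
      then show ?thesis using fin
        by (intro ex_has_greatest_nat[where b = "Suc (Max (d ` V))" and k = v]) (auto simp: less_Suc_eq_le)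
    qed
    then obtain x where x: "x \<in> V" "\<And>y. y \<in> V \<Longrightarrow> d y \<le> d x" by blast
    define N where "N = {v \<in> V. E x v}"
    define M where "M = V - N"
    have NM: "finite N" "finite M" "N \<inter> M = {}" "V = N \<union> M" using fin by (auto simp: N_def M_def)
    have "cliques E N (Suc p) = {}"
    proof (rule ccontr)
      assume "cliques E N (Suc p) \<noteq> {}"
      then obtain S where S: "S \<in> cliques E N (Suc p)" by blast
      then have SN: "S \<subseteq> N" by (simp add: cliques_def)
      then have "finite S" using NM(1) by (rule finite_subset)
      moreover have "x \<notin> S" using SN irr by (auto simp: N_def)
      moreover have "E x u" "E u x" if "u \<in> S" for u using SN that sym[of x u] by (auto simp: N_def)
      ultimately have "insert x S \<in> cliques E V (Suc (Suc p))"
        using S x(1) SN by (auto simp: cliques_def N_def)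
      then show False using Suc.prems by simp
    qed
    then obtain g where g: "g ` N \<subseteq> {..<p}"
      "npairs E N N + npairs (\<lambda>u v. E u v \<and> g u = g v) N N \<le> npairs (\<lambda>u v. g u \<noteq> g v) N N"
      using Suc.IH[OF NM(1)] by blast
    define h where "h v = (if v \<in> N then g v else p)" for v
    have gp: "g v \<noteq> p" if "v \<in> N" for v using g(1) that by auto
    have "h ` V \<subseteq> {..<Suc p}" using g(1) NM by (auto simp: h_def less_Suc_eq)
    moreover have "npairs E V V + npairs (\<lambda>u v. E u v \<and> h u = h v) V V \<le> npairs (\<lambda>u v. h u \<noteq> h v) V V"
    proof -
      have symE: "E u v \<and> h u = h v \<longleftrightarrow> E v u \<and> h v = h u" for u v using sym by auto
      have hN: "h v = g v" if "v \<in> N" for v using that by (simp add: h_def)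
      have hM: "h v = p" if "v \<in> M" for v using that by (simp add: h_def M_def)
      have hMN: "h u \<noteq> h v" if "u \<in> M" "v \<in> N" for u v
        using that gp[of v] by (simp add: hN hM)
      have 1: "npairs (\<lambda>u v. E u v \<and> h u = h v) M N = 0" "npairs (\<lambda>u v. E u v \<and> h u = h v) M M = npairs E M M"
        "npairs (\<lambda>u v. E u v \<and> h u = h v) N N = npairs (\<lambda>u v. E u v \<and> g u = g v) N N"
        using hMN by (auto intro!: npairs_eq_0 npairs_cong simp: hN hM)
      have 2: "npairs (\<lambda>u v. h u \<noteq> h v) M M = 0" "npairs (\<lambda>u v. h u \<noteq> h v) N N = npairs (\<lambda>u v. g u \<noteq> g v) N N"
        by (auto intro!: npairs_eq_0 npairs_cong simp: hN hM)
      have 3: "npairs (\<lambda>u v. h u \<noteq> h v) M N = card M * card N"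
      proof -
        have "{v \<in> N. h u \<noteq> h v} = N" if "u \<in> M" for u
          using that hMN by auto
        then show ?thesis by (simp add: npairs_def)
      qed
      have "npairs E M V \<le> card M * card N"
      proof -
        have "card {v \<in> V. E u v} \<le> card N" if "u \<in> M" for u
          using x(2)[of u] that by (auto simp: d_def N_def M_def)
        then show ?thesis unfolding npairs_def using sum_bounded_above[of M _ "card N"] by simp
      qed
      then have 4: "npairs E M N + npairs E M M \<le> card M * card N"
        using NM by (simp add: npairs_Un_right)
      have "npairs E V V + npairs (\<lambda>u v. E u v \<and> h u = h v) V V
        = (npairs E N N + npairs (\<lambda>u v. E u v \<and> g u = g v) N N) + 2 * (npairs E M N + npairs E M M)"
        unfolding NM(4) npairs_square_Un[OF NM(1-3) sym] npairs_square_Un[OF NM(1-3), of "\<lambda>u v. E u v \<and> h u = h v", OF symE]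
        using 1 by simp
      also have "\<dots> \<le> npairs (\<lambda>u v. g u \<noteq> g v) N N + 2 * (card M * card N)"
        by (intro add_mono mult_le_mono2 g(2) 4)
      also have "\<dots> = npairs (\<lambda>u v. h u \<noteq> h v) V V"
        unfolding NM(4) by (subst npairs_square_Un[OF NM(1-3)]) (auto simp: 2 3)
      finally show ?thesis .
    qed
    ultimately show ?thesis by blast
  qed
qed

lemma npairs_same_part:
  fixes g :: "'a \<Rightarrow> nat"
  assumes "finite V" "g ` V \<subseteq> {..<p}"
  shows "npairs (\<lambda>u v. g u = g v) V V = (\<Sum>i<p. (card {v \<in> V. g v = i})\<^sup>2)"
proof -
  have "npairs (\<lambda>u v. g u = g v) V V = (\<Sum>i<p. \<Sum>u | u \<in> V \<and> g u = i. card {v \<in> V. g u = g v})"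
    unfolding npairs_def by (rule sum.group[symmetric]) (use assms in auto)
  also have "\<dots> = (\<Sum>i<p. \<Sum>u | u \<in> V \<and> g u = i. card {v \<in> V. g v = i})"
    by (intro sum.cong refl arg_cong[of _ _ card]) auto
  finally show ?thesis by (simp add: power2_eq_square)
qed

lemma sum_card_parts:
  fixes g :: "'a \<Rightarrow> nat"
  assumes "finite V" "g ` V \<subseteq> {..<p}"
  shows "(\<Sum>i<p. card {v \<in> V. g v = i}) = card V"
proof -
  have "card V = (\<Sum>v\<in>V. 1)" by simp
  also have "\<dots> = (\<Sum>i<p. \<Sum>u | u \<in> V \<and> g u = i. 1)"
    by (rule sum.group[symmetric]) (use assms in auto)
  finally show ?thesis by simp
qed

text \<open>The exact deficit against the balanced partition, which later bounds the deviation of every single part size.\<close>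

lemma npairs_cross:
  fixes g :: "'a \<Rightarrow> nat"
  assumes fin: "finite V" and g: "g ` V \<subseteq> {..<p}" and p: "0 < p"
  shows "real (npairs (\<lambda>u v. g u \<noteq> g v) V V) =
    (1 - 1 / p) * (card V)\<^sup>2 - (\<Sum>i<p. (card {v \<in> V. g v = i} - card V / p)\<^sup>2)"
proof -
  define a where "a i = real (card {v \<in> V. g v = i})" for i
  define n where "n = real (card V)"
  have sa: "(\<Sum>i<p. a i) = n" using sum_card_parts[OF fin g] unfolding a_def n_def
    by (metis of_nat_sum)
  have "npairs (\<lambda>u v. True) V V = card V * card V" by (simp add: npairs_def)
  then have "real (npairs (\<lambda>u v. g u = g v) V V) + real (npairs (\<lambda>u v. g u \<noteq> g v) V V)
      = real (card V) * real (card V)"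
    using npairs_split[OF fin fin, of "\<lambda>_ _. True" "\<lambda>u v. g u = g v"]
    by (simp flip: of_nat_add of_nat_mult)
  then have "real (npairs (\<lambda>u v. g u \<noteq> g v) V V) = n * n - real (npairs (\<lambda>u v. g u = g v) V V)"
    unfolding n_def by linarith
  also have "real (npairs (\<lambda>u v. g u = g v) V V) = (\<Sum>i<p. (a i)\<^sup>2)"
    unfolding npairs_same_part[OF fin g] a_def by simp
  finally have 1: "real (npairs (\<lambda>u v. g u \<noteq> g v) V V) = n * n - (\<Sum>i<p. (a i)\<^sup>2)" .
  have "(\<Sum>i<p. (a i - n / p)\<^sup>2) = (\<Sum>i<p. (a i)\<^sup>2) - 2 * (n / p) * (\<Sum>i<p. a i) + p * (n / p)\<^sup>2"
    by (simp add: power2_diff sum.distrib sum_subtractf sum_distrib_left sum_divide_distrib mult_ac)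
  also have "\<dots> = (\<Sum>i<p. (a i)\<^sup>2) - n * n / p" using p
    by (simp add: sa power2_eq_square field_simps)
  finally show ?thesis using 1 by (simp add: a_def n_def power2_eq_square algebra_simps)
qed

lemma exists_max_cut:
  assumes fin: "finite V" and sym: "\<And>u v. E u v \<longleftrightarrow> E v u" and irr: "\<And>u. \<not> E u u"
    and f: "f ` V \<subseteq> {..<p::nat}"
  obtains g where "g ` V \<subseteq> {..<p}"
    "npairs (\<lambda>u v. E u v \<and> f u \<noteq> f v) V V \<le> npairs (\<lambda>u v. E u v \<and> g u \<noteq> g v) V V"
    "\<And>v j. \<lbrakk>v \<in> V; j < p\<rbrakk> \<Longrightarrow> card {u \<in> V. E v u \<and> g u = g v} \<le> card {u \<in> V. E v u \<and> g u = j}"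
proof -
  define c where "c g = npairs (\<lambda>u v. E u v \<and> g u \<noteq> g v) V V" for g :: "'a \<Rightarrow> nat"
  have "c g < Suc (npairs E V V)" for g
    unfolding c_def less_Suc_eq_le using fin by (intro npairs_mono) auto
  then have "\<exists>g. g ` V \<subseteq> {..<p} \<and> (\<forall>h. h ` V \<subseteq> {..<p} \<longrightarrow> c h \<le> c g)"
    using f by (intro ex_has_greatest_nat[where b = "Suc (npairs E V V)" and k = f]) auto
  then obtain g where g: "g ` V \<subseteq> {..<p}" "\<And>h. h ` V \<subseteq> {..<p} \<Longrightarrow> c h \<le> c g" by blast
  have "card {u \<in> V. E v u \<and> g u = g v} \<le> card {u \<in> V. E v u \<and> g u = j}" if v: "v \<in> V" "j < p" for v j
  proof -
    define W where "W = V - {v}"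
    have W: "V = W \<union> {v}" "finite W" "W \<inter> {v} = {}" using v fin by (auto simp: W_def)
    have c: "c h = npairs (\<lambda>u v. E u v \<and> h u \<noteq> h v) W W + 2 * card {u \<in> V. E v u \<and> h u \<noteq> h v}" for h
    proof -
      have symh: "E u v \<and> h u \<noteq> h v \<longleftrightarrow> E v u \<and> h v \<noteq> h u" for u v using sym by auto
      have "npairs (\<lambda>u v. E u v \<and> h u \<noteq> h v) {v} W = card {u \<in> V. E v u \<and> h u \<noteq> h v}"
        using irr by (auto simp: npairs_def W_def intro!: arg_cong[of _ _ card])
      moreover have "npairs (\<lambda>u v. E u v \<and> h u \<noteq> h v) {v} {v} = 0" by (simp add: npairs_def)
      ultimately show ?thesis unfolding c_def
        by (subst (1 2) W(1), subst npairs_square_Un[OF W(2) _ W(3) symh]) auto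
    qed
    define h where "h = g(v := j)"
    have "c h \<le> c g" using g v by (intro g(2)) (auto simp: h_def)
    moreover have "npairs (\<lambda>u v. E u v \<and> h u \<noteq> h v) W W = npairs (\<lambda>u v. E u v \<and> g u \<noteq> g v) W W"
      by (intro npairs_cong) (auto simp: h_def W_def)
    moreover have "{u \<in> V. E v u \<and> h u \<noteq> h v} = {u \<in> V. E v u \<and> g u \<noteq> j}"
      using irr by (auto simp: h_def)
    ultimately have le: "card {u \<in> V. E v u \<and> g u \<noteq> j} \<le> card {u \<in> V. E v u \<and> g u \<noteq> g v}"
      unfolding c by simp
    have "card {u \<in> V. E v u \<and> g u = i} + card {u \<in> V. E v u \<and> g u \<noteq> i} = card {u \<in> V. E v u}" for i
    proof -
      have "{u \<in> V. E v u} = {u \<in> V. E v u \<and> g u = i} \<union> {u \<in> V. E v u \<and> g u \<noteq> i}" by auto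
      then show ?thesis using fin by (simp add: card_Un_disjoint disjoint_iff)
    qed
    from this[of j] this[of "g v"] show ?thesis using le by linarith
  qed
  then show thesis using that g f unfolding c_def by blast
qed

text \<open>Absence of \<open>B\<^bsub>r,1\<^esub>\<close>, expressed through cliques instead of subgraph copies.\<close>

definition bowtie_free :: "('a \<Rightarrow> 'a \<Rightarrow> bool) \<Rightarrow> 'a set \<Rightarrow> nat \<Rightarrow> bool" where
  "bowtie_free E V r \<longleftrightarrow> (\<forall>A\<in>cliques E V r. \<forall>B\<in>cliques E V r. card (A \<inter> B) \<noteq> 1)"

text \<open>Choose one \<open>r\<close>-clique \<open>C v\<close> through each vertex \<open>v\<close> that lies in any, and delete the edges from \<open>v\<close> to \<open>C v\<close>.
A surviving \<open>r\<close>-clique through \<open>v\<close> would meet \<open>C v\<close> in a second vertex, but the edge from \<open>v\<close> to that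
vertex is gone.\<close>

lemma bowtie_free_clique_deletion:
  assumes fin: "finite V" and sym: "\<And>u v. E u v \<longleftrightarrow> E v u"
    and bf: "bowtie_free E V r" and "0 < r"
  obtains E' where "\<And>u v. E' u v \<longleftrightarrow> E' v u" "\<And>u v. E' u v \<Longrightarrow> E u v" "cliques E' V r = {}"
    "npairs (\<lambda>u v. E u v \<and> \<not> E' u v) V V \<le> 2 * r * card V"
proof -
  \<comment> \<open>An arbitrary set if no clique contains \<open>v\<close>; hence the first conjunct of \<open>D\<close>.\<close>
  define C where "C v = (SOME A. A \<in> cliques E V r \<and> v \<in> A)" for v
  have C: "C v \<in> cliques E V r" "v \<in> C v" if "A \<in> cliques E V r" "v \<in> A" for v A
    using someI[of "\<lambda>A. A \<in> cliques E V r \<and> v \<in> A" A] that by (auto simp: C_def)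
  define D where "D u v \<longleftrightarrow> C u \<in> cliques E V r \<and> v \<in> C u" for u v
  define E' where "E' u v \<longleftrightarrow> E u v \<and> \<not> D u v \<and> \<not> D v u" for u v
  have "cliques E' V r = {}"
  proof (rule ccontr)
    assume "cliques E' V r \<noteq> {}"
    then obtain K where K: "K \<in> cliques E' V r" by blast
    then have K': "K \<in> cliques E V r" by (auto simp: cliques_def E'_def)
    have "K \<noteq> {}" using K \<open>0 < r\<close> by (auto simp: cliques_def)
    then obtain v where v: "v \<in> K" by blast
    have Cv: "C v \<in> cliques E V r" "v \<in> C v" using C K' v by blast+
    have "K \<inter> C v \<noteq> {v}"
    proof
      assume "K \<inter> C v = {v}"
      then have "card (K \<inter> C v) = 1" by simp
      then show False using bf K' Cv by (auto simp: bowtie_free_def)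
    qed
    then obtain u where u: "u \<in> K" "u \<in> C v" "u \<noteq> v" using v Cv by blast
    have "E' v u" using K u v by (simp add: cliques_def)
    moreover have "D v u" using u Cv by (simp add: D_def)
    ultimately show False by (simp add: E'_def)
  qed
  moreover have "npairs (\<lambda>u v. E u v \<and> \<not> E' u v) V V \<le> 2 * r * card V"
  proof -
    have D: "npairs D V V \<le> r * card V"
    proof -
      have "card {v \<in> V. D u v} \<le> r" for u
      proof (cases "C u \<in> cliques E V r")
        case True
        then have "card (C u) = r" "finite (C u)" using fin by (auto simp: cliques_def dest: finite_subset)
        then show ?thesis using card_mono[of "C u" "{v \<in> V. D u v}"] by (auto simp: D_def)
      qed (simp add: D_def)
      then show ?thesis unfolding npairs_def using sum_bounded_above[of V _ r] by (simp add: mult.commute)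
    qed
    have "npairs (\<lambda>u v. E u v \<and> \<not> E' u v) V V \<le> npairs (\<lambda>u v. D u v \<or> D v u \<and> \<not> D u v) V V"
      by (intro npairs_mono fin) (auto simp: E'_def)
    also have "\<dots> = npairs D V V + npairs (\<lambda>u v. D v u \<and> \<not> D u v) V V"
      by (intro npairs_disj fin) auto
    also have "npairs (\<lambda>u v. D v u \<and> \<not> D u v) V V \<le> npairs (\<lambda>u v. D v u) V V"
      by (intro npairs_mono fin) auto
    also have "npairs (\<lambda>u v. D v u) V V = npairs D V V"
    proof -
      have "{(u, v). u \<in> V \<and> v \<in> V \<and> D v u} = prod.swap ` {(u, v). u \<in> V \<and> v \<in> V \<and> D u v}" by auto
      then show ?thesis using fin by (simp add: npairs_eq_card card_image)
    qed
    finally show ?thesis using D by simp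
  qed
  moreover have "E' u v \<longleftrightarrow> E' v u" for u v using sym by (auto simp: E'_def)
  moreover have "E' u v \<Longrightarrow> E u v" for u v by (auto simp: E'_def)
  ultimately show thesis using that by blast
qed

lemma npairs_eq_card_cliques:
  assumes fin: "finite V" and sym: "\<And>u v. E u v \<longleftrightarrow> E v u" and irr: "\<And>u. \<not> E u u"
  shows "npairs E V V = 2 * card (cliques E V 2)"
proof -
  have "2 * card (cliques E V (Suc 1)) = (\<Sum>B\<in>cliques E V 1. card (extenders E V B))"
    using sum_card_extenders[OF fin, of E 1] by simp
  also have "cliques E V 1 = (\<lambda>v. {v}) ` V" by (auto simp: cliques_def card_1_singleton_iff)
  also have "(\<Sum>B\<in>(\<lambda>v. {v}) ` V. card (extenders E V B)) = (\<Sum>v\<in>V. card (extenders E V {v}))"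
    by (subst sum.reindex) auto
  also have "\<dots> = npairs E V V" unfolding npairs_def
  proof (intro sum.cong refl arg_cong[of _ _ card])
    fix u assume "u \<in> V"
    moreover have "x \<noteq> u" "E x u" if "E u x" for x using that irr sym[of u x] by auto
    ultimately show "extenders E V {u} = {v \<in> V. E u v}"
      by (auto simp: extenders_def cliques_def)
  qed
  finally show ?thesis by (simp add: numeral_2_eq_2)
qed

text \<open>Every lost edge destroys at most \<open>card V ^ (k - 2)\<close> cliques, so the subgraph \<open>E'\<close> still has almost as many
\<open>k\<close>-cliques as the Turan graph, and by Moon--Moser almost as many edges.\<close>

lemma clique_rich_many_edges:
  assumes fin: "finite V" and sym: "\<And>u v. E u v \<longleftrightarrow> E v u" and irr: "\<And>u. \<not> E u u"
    and sym': "\<And>u v. E' u v \<longleftrightarrow> E' v u" and sub: "\<And>u v. E' u v \<Longrightarrow> E u v"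
    and free: "cliques E' V (Suc p) = {}"
    and lost: "npairs (\<lambda>u v. E u v \<and> \<not> E' u v) V V \<le> c * card V"
    and k: "2 \<le> k" "k \<le> p" and rich: "(p choose k) * (card V div p) ^ k \<le> card (cliques E V k)"
    and n: "n = real (card V)" "p \<le> card V"
  shows "(1 - 1 / p) * n\<^sup>2 * (1 - p / n) ^ k - (c * p ^ k / (p choose k)) * n \<le> npairs E' V V"
proof -
  define x where "x = n / p"
  define M where "M = real (card (cliques E' V k))"
  define N2 where "N2 = real (card (cliques E' V 2))"
  define q where "q = real (p choose k)"
  have p: "p > 0" using k by simp
  have pos: "n > 0" "x > 0" "q > 0" "p / n \<le> 1" using n k by (auto simp: x_def q_def)
  have "cliques E V k \<subseteq> cliques E' V k \<union> {S. S \<subseteq> V \<and> card S = k \<and>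
    (\<exists>(u, v)\<in>{(u, v). u \<in> V \<and> v \<in> V \<and> E u v \<and> \<not> E' u v}. u \<noteq> v \<and> u \<in> S \<and> v \<in> S)}"
    (is "_ \<subseteq> _ \<union> ?L") by (fastforce simp: cliques_def)
  then have "card (cliques E V k) \<le> card (cliques E' V k \<union> ?L)"
    using fin by (intro card_mono finite_UnI finite_cliques) auto
  also have "\<dots> \<le> card (cliques E' V k) + card ?L" by (rule card_Un_le)
  also have "card ?L \<le> card {(u, v). u \<in> V \<and> v \<in> V \<and> E u v \<and> \<not> E' u v} * card V ^ (k - 2)"
    by (rule card_sets_with_pair_le[OF fin]) auto
  also have "\<dots> \<le> (c * card V) * card V ^ (k - 2)"
    using lost fin by (intro mult_le_mono1) (simp add: npairs_eq_card)
  also have "\<dots> = c * card V ^ (k - 1)"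
  proof -
    have "k - 1 = Suc (k - 2)" using k by simp
    then show ?thesis by simp
  qed
  finally have "(p choose k) * (card V div p) ^ k \<le> card (cliques E' V k) + c * card V ^ (k - 1)"
    using rich by linarith
  then have "real ((p choose k) * (card V div p) ^ k) \<le> real (card (cliques E' V k) + c * card V ^ (k - 1))"
    by (simp only: of_nat_le_iff)
  then have "real ((p choose k) * (card V div p) ^ k) \<le> M + c * n ^ (k - 1)"
    unfolding M_def n(1) by simp
  moreover have "q * (x ^ k * (1 - p / n) ^ k) \<le> real ((p choose k) * (card V div p) ^ k)"
  proof -
    have "x * (1 - p / n) = n / p - 1" using pos p by (simp add: x_def field_simps)
    also have "\<dots> \<le> real (card V div p)"
    proof -
      have "card V = card V div p * p + card V mod p" by simp
      also have "\<dots> \<le> card V div p * p + p" using p by (intro add_left_mono) (simp add: less_imp_le)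
      finally have "n \<le> real (card V div p * p + p)" unfolding n(1) by (simp only: of_nat_le_iff)
      then show ?thesis using p by (simp add: field_simps)
    qed
    finally have "(x * (1 - p / n)) ^ k \<le> real (card V div p) ^ k"
      using pos by (intro power_mono) auto
    then show ?thesis by (simp add: q_def power_mult_distrib mult_left_mono)
  qed
  ultimately have 1: "q * (x ^ k * (1 - p / n) ^ k) - c * n ^ (k - 1) \<le> M" by linarith
  have kk: "2 + (k - 2) = k" using k by simp
  from clique_count_le[OF fin sym' free p, where j = 2 and i = "k - 2", unfolded kk, OF k(2)]
  have 2: "real (p choose 2) * M \<le> q * x ^ (k - 2) * N2"
    by (simp only: M_def N2_def q_def x_def n(1))
  have irr': "\<not> E' u u" for u using sub[of u u] irr[of u] by blast
  have e: "npairs E' V V = 2 * N2"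
    unfolding N2_def npairs_eq_card_cliques[OF fin sym' irr'] by simp
  have ch2: "2 * real (p choose 2) = p * (p - 1)"
  proof -
    have "2 * (p choose 2) = p * (p - 1)" using times_binomial_minus1_eq[of 2 p] by simp
    from arg_cong[OF this, of real] show ?thesis by simp
  qed
  have pw: "x ^ k = x ^ (k - 2) * x\<^sup>2" "n ^ (k - 1) = x ^ (k - 2) * (n * real p ^ (k - 2))"
  proof -
    have "k = (k - 2) + 2" using k by simp
    then show "x ^ k = x ^ (k - 2) * x\<^sup>2" by (simp flip: power_add)
    have "k - 1 = Suc (k - 2)" using k by simp
    then show "n ^ (k - 1) = x ^ (k - 2) * (n * real p ^ (k - 2))"
      using p by (simp add: x_def power_divide)
  qed
  have "q * x ^ (k - 2) * (real (p choose 2) * (x\<^sup>2 * (1 - p / n) ^ k - c * real p ^ (k - 2) / q * n))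
    = real (p choose 2) * (q * (x ^ k * (1 - p / n) ^ k) - c * n ^ (k - 1))"
    unfolding pw using pos by (simp add: field_simps)
  also have "\<dots> \<le> real (p choose 2) * M" using 1 by (intro mult_left_mono) auto
  also have "\<dots> \<le> q * x ^ (k - 2) * N2" by (rule 2)
  finally have "real (p choose 2) * (x\<^sup>2 * (1 - p / n) ^ k - c * real p ^ (k - 2) / q * n) \<le> N2"
    using pos by simp
  then have 3: "p * (p - 1) * (x\<^sup>2 * (1 - p / n) ^ k - c * real p ^ (k - 2) / q * n) \<le> 2 * N2"
    unfolding ch2[symmetric] by simp
  have "real (p * (p - 1)) * x\<^sup>2 = (1 - 1 / p) * n\<^sup>2"
    using p by (simp add: x_def power2_eq_square field_simps of_nat_diff)
  moreover have "real (p * (p - 1)) * (c * real p ^ (k - 2) / q * n) \<le> (c * real p ^ k / q) * n"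
  proof -
    have "k = (k - 2) + 2" using k by simp
    then have "real p ^ k = real p ^ (k - 2) * (p * p)" by (simp flip: power_add power2_eq_square)
    moreover have "real (p * (p - 1)) \<le> real (p * p)" by (intro of_nat_mono mult_le_mono) auto
    then have "real (p * (p - 1)) * (c * real p ^ (k - 2) / q * n) \<le> real (p * p) * (c * real p ^ (k - 2) / q * n)"
      using pos by (intro mult_right_mono) auto
    ultimately show ?thesis by (simp add: mult_ac)
  qed
  ultimately show ?thesis using 3 unfolding e q_def[symmetric]
    by (simp add: right_diff_distrib mult.assoc[symmetric])
qed

text \<open>Fueredi's inequality, applied after the deletion, bounds the number of cross edges of some partition from below by
twice the number of edges minus the number of cross pairs. A maximum cut of the original graph has at least as many
cross edges and in addition the local optimality on which the structural analysis rests.\<close>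

theorem clique_rich_max_cut:
  fixes \<delta> :: real
  assumes k: "2 \<le> k" "k \<le> p" and "0 < \<delta>"
  shows "\<forall>\<^sub>F n in sequentially. \<forall>(V :: 'a set) E. finite V \<and> card V = n \<and> (\<forall>u v. E u v \<longleftrightarrow> E v u) \<and> (\<forall>u. \<not> E u u)
    \<and> bowtie_free E V (Suc p) \<and> (p choose k) * (n div p) ^ k \<le> card (cliques E V k) \<longrightarrow>
    (\<exists>g. g ` V \<subseteq> {..<p} \<and> (1 - 1 / p - \<delta>) * (real n)\<^sup>2 \<le> npairs (\<lambda>u v. E u v \<and> g u \<noteq> g v) V V \<and>
      (\<forall>v\<in>V. \<forall>j<p. card {u \<in> V. E v u \<and> g u = g v} \<le> card {u \<in> V. E v u \<and> g u = j}))"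
proof -
  define c where "c = 2 * Suc p"
  define K where "K = c * real (p ^ k) / (p choose k)"
  have "((\<lambda>n. 2 * ((1 - 1 / p) * (1 - (1 - real p / real n) ^ k) + K / real n)) \<longlongrightarrow>
     2 * ((1 - 1 / p) * (1 - (1 - 0) ^ k) + 0)) sequentially"
    by (intro tendsto_intros lim_const_over_n)
  then have "\<forall>\<^sub>F n in sequentially. 2 * ((1 - 1 / p) * (1 - (1 - real p / real n) ^ k) + K / real n) < \<delta>"
    using \<open>0 < \<delta>\<close> by (intro order_tendstoD(2)) auto
  then show ?thesis using eventually_ge_at_top[of p]
  proof eventually_elim
    case (elim n)
    have p: "p > 0" using k by simp
    show ?case
    proof (intro allI impI, elim conjE)
      fix V :: "'a set" and E
      assume fin: "finite V" and n: "card V = n" and "\<forall>u v. E u v \<longleftrightarrow> E v u" and "\<forall>u. \<not> E u u"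
        and bf: "bowtie_free E V (Suc p)" and rich: "(p choose k) * (n div p) ^ k \<le> card (cliques E V k)"
      then have sym: "\<And>u v. E u v \<longleftrightarrow> E v u" and irr: "\<And>u. \<not> E u u" by blast+
      obtain E' where E': "\<And>u v. E' u v \<longleftrightarrow> E' v u" "\<And>u v. E' u v \<Longrightarrow> E u v" "cliques E' V (Suc p) = {}"
        "npairs (\<lambda>u v. E u v \<and> \<not> E' u v) V V \<le> 2 * Suc p * card V"
        by (rule bowtie_free_clique_deletion[OF fin sym bf zero_less_Suc]) (rule that)
      have irr': "\<not> E' u u" for u using E'(2)[of u u] irr[of u] by blast
      have many: "(1 - 1 / p) * (real n)\<^sup>2 * (1 - p / n) ^ k - K * n \<le> npairs E' V V"
        using clique_rich_many_edges[OF fin sym irr E' k, of "real n"] rich n elim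
        by (simp add: K_def c_def)
      obtain f where f: "f ` V \<subseteq> {..<p}"
        "npairs E' V V + npairs (\<lambda>u v. E' u v \<and> f u = f v) V V \<le> npairs (\<lambda>u v. f u \<noteq> f v) V V"
        using Fueredi_stability[OF fin E'(1) irr' E'(3)] by blast
      obtain g where g: "g ` V \<subseteq> {..<p}"
        "npairs (\<lambda>u v. E u v \<and> f u \<noteq> f v) V V \<le> npairs (\<lambda>u v. E u v \<and> g u \<noteq> g v) V V"
        "\<And>v j. \<lbrakk>v \<in> V; j < p\<rbrakk> \<Longrightarrow> card {u \<in> V. E v u \<and> g u = g v} \<le> card {u \<in> V. E v u \<and> g u = j}"
        by (rule exists_max_cut[OF fin sym irr f(1)]) (rule that)
      have "npairs E' V V = npairs (\<lambda>u v. E' u v \<and> f u = f v) V V + npairs (\<lambda>u v. E' u v \<and> f u \<noteq> f v) V V"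
        by (rule npairs_split[OF fin fin])
      moreover have "npairs (\<lambda>u v. E' u v \<and> f u \<noteq> f v) V V \<le> npairs (\<lambda>u v. E u v \<and> f u \<noteq> f v) V V"
        using E'(2) by (intro npairs_mono fin) auto
      ultimately have 1: "2 * npairs E' V V \<le> npairs (\<lambda>u v. f u \<noteq> f v) V V + npairs (\<lambda>u v. E u v \<and> g u \<noteq> g v) V V"
        using f(2) g(2) by linarith
      define b e x y z where "b = (1 - 1 / p) * (real n)\<^sup>2" and "e = real (npairs E' V V)"
        and "x = real (npairs (\<lambda>u v. f u \<noteq> f v) V V)"
        and "y = real (npairs (\<lambda>u v. E u v \<and> g u \<noteq> g v) V V)" and "z = (1 - p / n) ^ k"
      have "2 * e \<le> x + y" using 1 unfolding e_def x_def y_def by (simp flip: of_nat_add)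
      moreover have "x \<le> b"
        unfolding x_def b_def npairs_cross[OF fin f(1) p] n by (simp add: sum_nonneg)
      moreover have "b * z - K * n \<le> e" using many by (simp add: b_def z_def e_def)
      moreover have "2 * b - 2 * (b * z) + 2 * (K * n) \<le> \<delta> * (real n)\<^sup>2"
      proof -
        have "n > 0" using elim p by simp
        then have "2 * b - 2 * (b * z) + 2 * (K * n)
          = 2 * ((1 - 1 / p) * (1 - (1 - real p / real n) ^ k) + K / real n) * (real n)\<^sup>2"
          unfolding b_def z_def by (simp add: field_simps power2_eq_square)
        also have "\<dots> \<le> \<delta> * (real n)\<^sup>2"
          using elim by (intro mult_right_mono) auto
        finally show ?thesis .
      qed
      ultimately have "b - \<delta> * (real n)\<^sup>2 \<le> y" by linarith
      then have "(1 - 1 / p - \<delta>) * (real n)\<^sup>2 \<le> npairs (\<lambda>u v. E u v \<and> g u \<noteq> g v) V V"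
        unfolding b_def y_def by (simp add: left_diff_distrib)
      then show "\<exists>g. g ` V \<subseteq> {..<p} \<and> (1 - 1 / p - \<delta>) * (real n)\<^sup>2 \<le> npairs (\<lambda>u v. E u v \<and> g u \<noteq> g v) V V \<and>
        (\<forall>v\<in>V. \<forall>j<p. card {u \<in> V. E v u \<and> g u = g v} \<le> card {u \<in> V. E v u \<and> g u = j})"
        using g by blast
    qed
  qed
qed

section \<open>Local structure of graphs close to the Turan graph\<close>

text \<open>A bowtie-free graph with a \<open>p\<close>-cut that is locally optimal and misses at most \<open>\<epsilon>\<^sup>2 n\<^sup>2\<close> ordered
cross pairs. With the square, at most \<open>\<epsilon> n\<close> vertices miss more than \<open>\<epsilon> n\<close> neighbours, and part sizes deviate from
\<open>n / p\<close> by at most \<open>\<epsilon> n\<close>. The bounds on \<open>\<epsilon>\<close> and on the order leave room for the greedy choices below: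
at most four vertices missing \<open>n / (8 p)\<close> neighbours each leave half of every part, and each of at most \<open>p\<close> typical
vertices removes a further \<open>\<epsilon> n\<close>.\<close>

locale near_turan =
  fixes V :: "'a set" and E :: "'a \<Rightarrow> 'a \<Rightarrow> bool" and p :: nat and g :: "'a \<Rightarrow> nat" and \<epsilon> :: real
  assumes fin: "finite V" and sym: "\<And>u v. E u v \<longleftrightarrow> E v u" and irr: "\<And>u. \<not> E u u"
    and bowtie_free: "bowtie_free E V (Suc p)" and p: "2 \<le> p"
    and g: "g ` V \<subseteq> {..<p}"
    and many: "(1 - 1 / p - \<epsilon>\<^sup>2) * (real (card V))\<^sup>2 \<le> npairs (\<lambda>u v. E u v \<and> g u \<noteq> g v) V V"
    and max_cut: "\<And>v j. \<lbrakk>v \<in> V; j < p\<rbrakk> \<Longrightarrow> card {u \<in> V. E v u \<and> g u = g v} \<le> card {u \<in> V. E v u \<and> g u = j}"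
    and eps: "0 < \<epsilon>" "8 * real p * real p * \<epsilon> \<le> 1"
    and large: "3 * real p + 8 \<le> \<epsilon> * card V"
begin

abbreviation n :: real where "n \<equiv> real (card V)"

definition missing :: "'a \<Rightarrow> 'a set" where
  "missing v = {u \<in> V. g v \<noteq> g u \<and> \<not> E v u}"

text \<open>Two thresholds are needed. Vertices outside \<open>atypical\<close> miss so little that \<open>p\<close> of them still have common
neighbours in each other part; they are the building material for cliques. Vertices outside \<open>exceptional\<close> miss
so little that a few of them can be prescribed. The coarser threshold does not shrink with \<open>\<epsilon>\<close>, and therefore an
exceptional vertex loses more cliques than its few inner neighbours can bring.\<close>

definition atypical :: "'a set" where
  "atypical = {v \<in> V. \<epsilon> * n < card (missing v)}"

definition exceptional :: "'a set" where
  "exceptional = {v \<in> V. n / (8 * p) < card (missing v)}"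

lemma n_pos: "0 < n"
  using large by (cases "card V = 0") auto

lemma eps_small: "\<epsilon> * n \<le> n / (8 * real p * real p)"
proof -
  have "8 * real p * real p * (\<epsilon> * n) \<le> 1 * n"
    using mult_right_mono[OF eps(2), of n] by (simp add: mult_ac)
  then show ?thesis using p by (simp add: field_simps)
qed

lemma missing_total: "(\<Sum>v\<in>V. real (card (missing v))) \<le> \<epsilon>\<^sup>2 * n\<^sup>2"
  and part_size: "i < p \<Longrightarrow> \<bar>real (card {v \<in> V. g v = i}) - n / p\<bar> \<le> \<epsilon> * n"
proof -
  define s where "s = (\<Sum>i<p. (real (card {v \<in> V. g v = i}) - n / p)\<^sup>2)"
  define c where "c = real (npairs (\<lambda>u v. E u v \<and> g u \<noteq> g v) V V)"
  define x where "x = real (npairs (\<lambda>u v. g u \<noteq> g v) V V)"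
  define b where "b = (1 - 1 / p) * n\<^sup>2"
  have "0 < p" using p by simp
  have x: "x = b - s" unfolding x_def s_def b_def using npairs_cross[OF fin g \<open>0 < p\<close>] by simp
  have m: "b - \<epsilon>\<^sup>2 * n\<^sup>2 \<le> c" using many by (simp add: b_def c_def left_diff_distrib)
  have "npairs (\<lambda>u v. g u \<noteq> g v) V V = npairs (\<lambda>u v. g u \<noteq> g v \<and> E u v) V V + npairs (\<lambda>u v. g u \<noteq> g v \<and> \<not> E u v) V V"
    by (rule npairs_split[OF fin fin])
  moreover have "npairs (\<lambda>u v. g u \<noteq> g v \<and> E u v) V V = npairs (\<lambda>u v. E u v \<and> g u \<noteq> g v) V V"
    by (intro npairs_cong) auto
  moreover have "npairs (\<lambda>u v. g u \<noteq> g v \<and> \<not> E u v) V V = (\<Sum>v\<in>V. card (missing v))"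
    by (simp add: npairs_def missing_def)
  ultimately have sp: "x = c + (\<Sum>v\<in>V. real (card (missing v)))"
    unfolding x_def c_def by simp
  have "s \<ge> 0" unfolding s_def by (intro sum_nonneg) auto
  then show "(\<Sum>v\<in>V. real (card (missing v))) \<le> \<epsilon>\<^sup>2 * n\<^sup>2" using x m sp by linarith
  have "(\<Sum>v\<in>V. real (card (missing v))) \<ge> 0" by (intro sum_nonneg) auto
  then have s: "s \<le> (\<epsilon> * n)\<^sup>2" using x m sp by (simp add: power_mult_distrib)
  show "\<bar>real (card {v \<in> V. g v = i}) - n / p\<bar> \<le> \<epsilon> * n" if "i < p"
  proof -
    have "(real (card {v \<in> V. g v = i}) - n / p)\<^sup>2 \<le> s"
      unfolding s_def by (rule member_le_sum) (use that in auto)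
    then have "(real (card {v \<in> V. g v = i}) - n / p)\<^sup>2 \<le> (\<epsilon> * n)\<^sup>2" using s by simp
    then have "\<bar>real (card {v \<in> V. g v = i}) - n / p\<bar> \<le> \<bar>\<epsilon> * n\<bar>" by (simp only: abs_le_square_iff)
    then show ?thesis using eps by simp
  qed
qed

lemma card_atypical: "card atypical \<le> \<epsilon> * n"
proof -
  have "card atypical * (\<epsilon> * n) = (\<Sum>v\<in>atypical. \<epsilon> * n)" by simp
  also have "\<dots> \<le> (\<Sum>v\<in>atypical. real (card (missing v)))"
    by (intro sum_mono) (auto simp: atypical_def)
  also have "\<dots> \<le> (\<Sum>v\<in>V. real (card (missing v)))"
    using fin by (intro sum_mono2) (auto simp: atypical_def)
  also have "\<dots> \<le> (\<epsilon> * n) * (\<epsilon> * n)" using missing_total by (simp add: power2_eq_square mult_ac)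
  finally show ?thesis
    by (rule mult_right_le_imp_le) (use eps n_pos in simp)
qed

lemma finite_missing: "finite (missing v)" and finite_atypical: "finite atypical"
  using fin by (auto simp: missing_def atypical_def)

text \<open>A transversal clique of typical vertices, chosen part by part: each vertex chosen so far excludes at most \<open>\<epsilon> n\<close>
candidates. The set \<open>X\<close> makes it possible to keep a second clique disjoint from a first one.\<close>

lemma greedy_clique:
  assumes "finite J" "finite X" "\<And>j. j \<in> J \<Longrightarrow> A j \<subseteq> {v \<in> V - atypical. g v = j}"
    and "\<And>j. j \<in> J \<Longrightarrow> card X + card J * (\<epsilon> * n) < card (A j)"
  shows "\<exists>S \<in> cliques E V (card J). S \<inter> X = {} \<and> S \<subseteq> (\<Union>j\<in>J. A j)"
  using assms(1,3,4)
proof (induction J rule: finite_induct)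
  case empty
  then show ?case by (auto simp: cliques_def)
next
  case (insert j J)
  have en: "0 \<le> \<epsilon> * n" using eps by simp
  have "card X + card J * (\<epsilon> * n) < card (A i)" if "i \<in> J" for i
    using insert.prems(2)[of i] that insert.hyps en by (auto simp: algebra_simps)
  then obtain S where S: "S \<in> cliques E V (card J)" "S \<inter> X = {}" "S \<subseteq> (\<Union>j\<in>J. A j)"
    using insert.IH insert.prems(1) by blast
  have SV: "S \<subseteq> V" "card S = card J" using S by (auto simp: cliques_def)
  then have "finite S" using fin finite_subset by blast
  have gS: "g s \<in> J" "s \<notin> atypical" if "s \<in> S" for s
    using S(3) that insert.prems(1) by blast+
  define B where "B = X \<union> (\<Union>s\<in>S. missing s)"
  have "finite B" using \<open>finite S\<close> \<open>finite X\<close> finite_missing by (auto simp: B_def)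
  have "real (card B) \<le> card X + card J * (\<epsilon> * n)"
  proof -
    have "card B \<le> card X + card (\<Union>s\<in>S. missing s)" unfolding B_def by (rule card_Un_le)
    also have "card (\<Union>s\<in>S. missing s) \<le> (\<Sum>s\<in>S. card (missing s))"
      by (rule card_UN_le[OF \<open>finite S\<close>])
    finally have "real (card B) \<le> card X + (\<Sum>s\<in>S. real (card (missing s)))"
      by (simp flip: of_nat_sum of_nat_add)
    also have "(\<Sum>s\<in>S. real (card (missing s))) \<le> (\<Sum>s\<in>S. \<epsilon> * n)"
      using gS(2) SV by (intro sum_mono) (force simp: atypical_def)
    finally show ?thesis using SV by simp
  qed
  also have "\<dots> < card (A j)"
    using insert.prems(2)[of j] insert.hyps en by (auto simp: algebra_simps)
  finally have "\<not> A j \<subseteq> B" using card_mono[OF \<open>finite B\<close>, of "A j"] by auto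
  then obtain u where u: "u \<in> A j" "u \<notin> B" by blast
  have uV: "u \<in> V" "g u = j" using insert.prems(1)[of j] u by auto
  have Eu: "E s u" "E u s" if "s \<in> S" for s
  proof -
    have "g s \<noteq> g u" using gS(1)[OF that] uV insert.hyps by auto
    moreover have "u \<notin> missing s" using u that by (auto simp: B_def)
    ultimately show "E s u" using uV by (auto simp: missing_def)
    then show "E u s" using sym by simp
  qed
  have "u \<notin> S" using gS(1) uV insert.hyps by auto
  then have "insert u S \<in> cliques E V (card (insert j J))"
    using S(1) uV Eu \<open>finite S\<close> insert.hyps by (auto simp: cliques_def)
  moreover have "insert u S \<inter> X = {}" using S u by (auto simp: B_def)
  moreover have "insert u S \<subseteq> (\<Union>j\<in>insert j J. A j)" using S u by auto
  ultimately show ?case by blast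
qed

lemma no_bowtie:
  "\<lbrakk>A \<in> cliques E V (Suc p); B \<in> cliques E V (Suc p); A \<inter> B = {x}\<rbrakk> \<Longrightarrow> False"
  using bowtie_free unfolding bowtie_free_def by (metis is_singletonI is_singleton_altdef)

lemma insert_clique:
  assumes "S \<in> cliques E V m" "v \<in> V" "\<And>s. s \<in> S \<Longrightarrow> E v s"
  shows "insert v S \<in> cliques E V (Suc m)"
proof -
  have "v \<notin> S" using assms(3) irr by blast
  moreover have "finite S" using assms(1) fin by (auto simp: cliques_def dest: finite_subset)
  moreover have "E s v" if "s \<in> S" for s using assms(3)[OF that] sym by simp
  ultimately show ?thesis using assms by (auto simp: cliques_def)
qed

text \<open>A vertex with many neighbours in its own part has as many in every part, by the optimality of the
cut. Two disjoint transversal cliques in its neighbourhood then form a bowtie centred at the vertex.\<close>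

lemma inner_degree:
  assumes v: "v \<in> V"
  shows "card {u \<in> V. E v u \<and> g u = g v} \<le> (real p + 3) * \<epsilon> * n"
proof (rule ccontr)
  assume "\<not> ?thesis"
  then have big: "(real p + 3) * \<epsilon> * n < card {u \<in> V. E v u \<and> g u = g v}" by simp
  define A where "A j = {u \<in> V. E v u \<and> g u = j} - atypical" for j
  have cA: "card X + card {..<p} * (\<epsilon> * n) < card (A j)" if "j < p" "card X \<le> Suc p" for j X
  proof -
    have "card {u \<in> V. E v u \<and> g u = g v} \<le> card {u \<in> V. E v u \<and> g u = j}"
      using max_cut v that by blast
    also have "\<dots> \<le> card (A j) + card atypical"
      unfolding A_def using diff_card_le_card_Diff[OF finite_atypical, of "{u \<in> V. E v u \<and> g u = j}"] by linarith
    finally have "real (card {u \<in> V. E v u \<and> g u = g v}) \<le> card (A j) + card atypical" by (simp flip: of_nat_add)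
    then have "(real p + 3) * \<epsilon> * n < card (A j) + \<epsilon> * n" using big card_atypical by linarith
    moreover have "real (card X) \<le> \<epsilon> * n" using that(2) large p by linarith
    ultimately show ?thesis using eps n_pos by (simp add: algebra_simps)
  qed
  have A: "A j \<subseteq> {v \<in> V - atypical. g v = j}" for j by (auto simp: A_def)
  obtain S where S: "S \<in> cliques E V (card {..<p})" "S \<inter> {v} = {}" "S \<subseteq> (\<Union>j\<in>{..<p}. A j)"
    using greedy_clique[of "{..<p}" "{v}" A] A cA[of _ "{v}"] by auto
  have "card S = p" "finite S" using S(1) fin by (auto simp: cliques_def dest: finite_subset)
  then have "card (insert v S) \<le> Suc p" by (simp add: card_insert_if)
  then obtain T where T: "T \<in> cliques E V (card {..<p})" "T \<inter> insert v S = {}" "T \<subseteq> (\<Union>j\<in>{..<p}. A j)"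
    using greedy_clique[of "{..<p}" "insert v S" A] A cA[of _ "insert v S"] \<open>finite S\<close> by auto
  have "insert v S \<in> cliques E V (Suc p)" "insert v T \<in> cliques E V (Suc p)"
    using insert_clique[OF S(1) v] insert_clique[OF T(1) v] S(3) T(3) by (auto simp: A_def)
  moreover have "insert v S \<inter> insert v T = {v}" using T by auto
  ultimately show False by (rule no_bowtie)
qed

text \<open>The elements of \<open>Q\<close> are joined to the new clique but need not be adjacent to each other; this allows finding
a common neighbour of the ends of two different edges.\<close>

lemma extend_to_parts:
  assumes "Q \<subseteq> V - exceptional" "card Q \<le> 4" "J \<subseteq> {..<p}" "\<And>q. q \<in> Q \<Longrightarrow> g q \<notin> J"
    and "finite X" "card X \<le> p + 8"
  shows "\<exists>S \<in> cliques E V (card J). S \<inter> X = {} \<and> g ` S \<subseteq> J \<and> S \<inter> atypical = {} \<and> (\<forall>q\<in>Q. \<forall>s\<in>S. E q s)"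
proof -
  have fQ: "finite Q" using assms(1) fin finite_subset by blast
  have fJ: "finite J" "card J \<le> p" using assms(3) finite_subset card_mono[of "{..<p}" J] by auto
  define A where "A j = {v \<in> V. g v = j} - (atypical \<union> (\<Union>q\<in>Q. missing q))" for j
  have "card X + card J * (\<epsilon> * n) < card (A j)" if "j \<in> J" for j
  proof -
    have "real (card {v \<in> V. g v = j}) \<ge> n / p - \<epsilon> * n" using part_size[of j] that assms(3) by auto
    moreover have "card {v \<in> V. g v = j} \<le> card (A j) + card (atypical \<union> (\<Union>q\<in>Q. missing q))"
      unfolding A_def using diff_card_le_card_Diff[of "atypical \<union> (\<Union>q\<in>Q. missing q)" "{v \<in> V. g v = j}"]
        finite_atypical finite_missing fQ by auto
    moreover have "card (atypical \<union> (\<Union>q\<in>Q. missing q)) \<le> card atypical + (\<Sum>q\<in>Q. card (missing q))"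
      using card_Un_le card_UN_le[OF fQ, of missing] by (meson add_left_mono le_trans)
    moreover have "(\<Sum>q\<in>Q. real (card (missing q))) \<le> n / (2 * p)"
    proof -
      have "(\<Sum>q\<in>Q. real (card (missing q))) \<le> (\<Sum>q\<in>Q. n / (8 * p))"
        using assms(1) by (intro sum_mono) (force simp: exceptional_def)
      also have "\<dots> = card Q * (n / (8 * p))" by simp
      also have "\<dots> \<le> 4 * (n / (8 * p))" using assms(2) by (intro mult_right_mono) auto
      finally show ?thesis by simp
    qed
    ultimately have 1: "n / p - \<epsilon> * n \<le> real (card (A j)) + \<epsilon> * n + n / (2 * p)"
      using card_atypical by (simp flip: of_nat_sum)
    have "(real p + 3) * (\<epsilon> * n) < n / (2 * p)"
    proof -
      have "(real p + 3) * (\<epsilon> * n) \<le> (3 * real p) * (n / (8 * real p * real p))"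
        using eps_small p eps by (intro mult_mono) auto
      also have "\<dots> = 3 * n / (8 * p)" using p by simp
      also have "\<dots> < n / (2 * p)" using n_pos p by (simp add: field_simps)
      finally show ?thesis .
    qed
    moreover have "real (card X) \<le> \<epsilon> * n" using assms(6) large p by linarith
    moreover have "card J * (\<epsilon> * n) \<le> real p * (\<epsilon> * n)" using fJ eps by (intro mult_right_mono) auto
    moreover have "n / p = n / (2 * p) + n / (2 * p)" by simp
    ultimately show ?thesis using 1 by (simp only: distrib_right)
  qed
  moreover have "A j \<subseteq> {v \<in> V - atypical. g v = j}" for j by (auto simp: A_def)
  ultimately obtain S where S: "S \<in> cliques E V (card J)" "S \<inter> X = {}" "S \<subseteq> (\<Union>j\<in>J. A j)"
    using greedy_clique[OF fJ(1) assms(5), of A] by blast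
  have "g ` S \<subseteq> J" "S \<inter> atypical = {}" using S(3) by (auto simp: A_def)
  moreover have "E q s" if q: "q \<in> Q" and s: "s \<in> S" for q s
  proof -
    have "s \<in> V" "s \<notin> missing q" "g s \<in> J" using S(3) that by (auto simp: A_def)
    then show ?thesis using assms(4)[OF q] by (auto simp: missing_def)
  qed
  ultimately show ?thesis using S(1,2) by (intro bexI[of _ S] conjI ballI)
qed

lemma exceptional_subset: "exceptional \<subseteq> V" by (auto simp: exceptional_def)

lemma exceptional_subset_atypical: "exceptional \<subseteq> atypical"
proof
  fix v assume v: "v \<in> exceptional"
  have "n / (8 * real p * real p) \<le> n / (8 * p)" using p n_pos by (simp add: field_simps)
  then show "v \<in> atypical" using eps_small v by (auto simp: exceptional_def atypical_def)
qed

lemma card_exceptional: "card exceptional \<le> \<epsilon> * n"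
  using card_atypical card_mono[OF finite_atypical exceptional_subset_atypical] by linarith

lemma clique_through_inner_edge:
  assumes "x \<in> V - exceptional" "y \<in> V - exceptional" "E x y" "g x = g y" "finite X" "card X \<le> p + 8"
  shows "\<exists>A\<in>cliques E V (Suc p). x \<in> A \<and> y \<in> A \<and> A \<inter> X \<subseteq> {x, y}"
proof -
  have gx: "g x < p" using g assms by auto
  obtain S where S: "S \<in> cliques E V (card ({..<p} - {g x}))" "S \<inter> X = {}" "\<forall>q\<in>{x, y}. \<forall>s\<in>S. E q s"
  proof -
    have "\<exists>S \<in> cliques E V (card ({..<p} - {g x})). S \<inter> X = {} \<and> g ` S \<subseteq> {..<p} - {g x} \<and>
      S \<inter> atypical = {} \<and> (\<forall>q\<in>{x, y}. \<forall>s\<in>S. E q s)"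
      by (rule extend_to_parts) (use assms in \<open>auto simp: card_insert_if\<close>)
    then show thesis using that by blast
  qed
  have "insert x (insert y S) \<in> cliques E V (Suc (Suc (card ({..<p} - {g x}))))"
    using S assms by (intro insert_clique) auto
  moreover have "Suc (Suc (card ({..<p} - {g x}))) = Suc p" using gx by simp
  ultimately have "insert x (insert y S) \<in> cliques E V (Suc p)" by simp
  then show ?thesis using S(2) by (intro bexI[of _ "insert x (insert y S)"]) auto
qed

text \<open>Two inner edges sharing the vertex \<open>x\<close> extend to two \<open>(p + 1)\<close>-cliques that have only \<open>x\<close> in common.\<close>

lemma inner_edges_not_adjacent:
  assumes "x \<in> V - exceptional" "y \<in> V - exceptional" "z \<in> V - exceptional"
    "E x y" "g x = g y" "E x z" "g x = g z" "y \<noteq> z"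
  shows False
proof -
  obtain A where A: "A \<in> cliques E V (Suc p)" "x \<in> A" "y \<in> A" "A \<inter> {z} \<subseteq> {x, y}"
    using clique_through_inner_edge[of x y "{z}"] assms by auto
  have "finite A" "card A = Suc p" using A(1) fin by (auto simp: cliques_def dest: finite_subset)
  then obtain B where B: "B \<in> cliques E V (Suc p)" "x \<in> B" "z \<in> B" "B \<inter> A \<subseteq> {x, z}"
    using clique_through_inner_edge[of x z A] assms by auto
  have "z \<notin> A" using A(4) assms irr by auto
  then have "A \<inter> B = {x}" using A B by auto
  then show False using A B no_bowtie by blast
qed

text \<open>If some part \<open>j\<close> contains no end of the two inner edges, a common neighbour \<open>w\<close> of all four ends in that part serves
as the centre of a bowtie.\<close>

lemma inner_edges_common_part:
  assumes V: "{a, b, c, d} \<subseteq> V - exceptional" and e: "E a b" "g a = g b" "E c d" "g c = g d"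
    and disj: "{a, b} \<inter> {c, d} = {}" and j: "j < p" "j \<noteq> g a" "j \<noteq> g c"
  shows False
proof -
  have "card {a, b, c, d} \<le> 4" by (auto simp: card_insert_if)
  then obtain W where W: "W \<in> cliques E V (card {j})" "g ` W \<subseteq> {j}" "W \<inter> atypical = {}"
    "\<forall>q\<in>{a, b, c, d}. \<forall>s\<in>W. E q s"
  proof -
    have "\<exists>S \<in> cliques E V (card {j}). S \<inter> {} = {} \<and> g ` S \<subseteq> {j} \<and> S \<inter> atypical = {} \<and>
      (\<forall>q\<in>{a, b, c, d}. \<forall>s\<in>S. E q s)"
      by (rule extend_to_parts) (use V e j \<open>card {a, b, c, d} \<le> 4\<close> in auto)
    then show thesis using that by blast
  qed
  then obtain w where w: "W = {w}" by (auto simp: cliques_def card_1_singleton_iff)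
  have wV: "w \<in> V - exceptional" "g w = j" "E a w" "E b w" "E c w" "E d w"
    using W w exceptional_subset_atypical by (auto simp: cliques_def)
  have sz: "Suc (Suc (Suc (card ({..<p} - {g x, j})))) = Suc p" if "x \<in> {a, c}" for x
  proof -
    have "g x < p" using that V g by auto
    then have "card ({..<p} - {g x, j}) = p - 2" using j that by (auto simp: card_Diff_subset)
    then show ?thesis using p by simp
  qed
  obtain S where S: "S \<in> cliques E V (card ({..<p} - {g a, j}))" "S \<inter> {a, b, c, d, w} = {}"
    "\<forall>q\<in>{a, b, w}. \<forall>s\<in>S. E q s"
  proof -
    have "\<exists>S \<in> cliques E V (card ({..<p} - {g a, j})). S \<inter> {a, b, c, d, w} = {} \<and> g ` S \<subseteq> {..<p} - {g a, j} \<and>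
      S \<inter> atypical = {} \<and> (\<forall>q\<in>{a, b, w}. \<forall>s\<in>S. E q s)"
      by (rule extend_to_parts) (use V e wV in \<open>auto simp: card_insert_if\<close>)
    then show thesis using that by blast
  qed
  define A where "A = insert a (insert b (insert w S))"
  have "A \<in> cliques E V (Suc (Suc (Suc (card ({..<p} - {g a, j})))))"
    unfolding A_def using S V wV e by (intro insert_clique) auto
  then have A: "A \<in> cliques E V (Suc p)" using sz by simp
  have "finite S" "card S \<le> p" using S(1) fin sz[of a] by (auto simp: cliques_def dest: finite_subset)
  then have "finite (A \<union> {c, d})" "card (A \<union> {c, d}) \<le> p + 8"
    by (auto simp: A_def card_insert_if)
  then obtain T where T: "T \<in> cliques E V (card ({..<p} - {g c, j}))" "T \<inter> (A \<union> {c, d}) = {}"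
    "\<forall>q\<in>{c, d, w}. \<forall>s\<in>T. E q s"
  proof -
    have "\<exists>S \<in> cliques E V (card ({..<p} - {g c, j})). S \<inter> (A \<union> {c, d}) = {} \<and> g ` S \<subseteq> {..<p} - {g c, j} \<and>
      S \<inter> atypical = {} \<and> (\<forall>q\<in>{c, d, w}. \<forall>s\<in>S. E q s)"
      by (rule extend_to_parts) (use V e wV \<open>finite (A \<union> {c, d})\<close> \<open>card (A \<union> {c, d}) \<le> p + 8\<close> in \<open>auto simp: card_insert_if\<close>)
    then show thesis using that by blast
  qed
  define B where "B = insert c (insert d (insert w T))"
  have "B \<in> cliques E V (Suc (Suc (Suc (card ({..<p} - {g c, j})))))"
    unfolding B_def using T V wV e by (intro insert_clique) auto
  then have B: "B \<in> cliques E V (Suc p)" using sz by simp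
  have "A \<inter> B = {w}" using S(2) T(2) disj wV irr by (auto simp: A_def B_def)
  then show False using A B no_bowtie by blast
qed

text \<open>The only remaining possibility for two inner edges is that they lie in different parts and there are no further
parts. Then \<open>a\<close> cannot be adjacent to both ends of the other edge, since the triangle \<open>a, c, d\<close> and a
triangle on the edge \<open>a, b\<close> would meet in \<open>a\<close> alone.\<close>

lemma two_inner_edges:
  assumes V: "{a, b, c, d} \<subseteq> V - exceptional" and e: "E a b" "g a = g b" "E c d" "g c = g d"
    and ne: "{a, b} \<noteq> {c, d}"
  shows "p = 2" "g a \<noteq> g c" "\<not> (E a c \<and> E a d)"
proof -
  have disj: "{a, b} \<inter> {c, d} = {}"
  proof (rule ccontr)
    assume "{a, b} \<inter> {c, d} \<noteq> {}"
    then consider "a = c" | "a = d" | "b = c" | "b = d" by auto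
    then show False
    proof cases
      case 1
      then show ?thesis using V e ne by (intro inner_edges_not_adjacent[of a b d]) auto
    next
      case 2
      then show ?thesis using V e ne sym[of c d] by (intro inner_edges_not_adjacent[of a b c]) auto
    next
      case 3
      then show ?thesis using V e ne sym[of a b] by (intro inner_edges_not_adjacent[of b a d]) auto
    next
      case 4
      then show ?thesis using V e ne sym[of a b] sym[of c d] by (intro inner_edges_not_adjacent[of b a c]) auto
    qed
  qed
  have noj: "\<not> (\<exists>j<p. j \<noteq> g a \<and> j \<noteq> g c)" using inner_edges_common_part[OF V e disj] by blast
  have "{..<p} \<subseteq> {g a, g c}" using noj by auto
  then have "p \<le> card {g a, g c}" using card_mono[of "{g a, g c}" "{..<p}"] by simp
  then show ac: "g a \<noteq> g c" and p2: "p = 2" using p by (auto simp: card_insert_if split: if_splits)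
  show "\<not> (E a c \<and> E a d)"
  proof
    assume E: "E a c \<and> E a d"
    obtain A where A: "A \<in> cliques E V (Suc p)" "a \<in> A" "b \<in> A" "A \<inter> {c, d} \<subseteq> {a, b}"
    proof -
      have "card {c, d} \<le> p + 8" by (simp add: card_insert_if)
      then show thesis using clique_through_inner_edge[of a b "{c, d}"] V e that by blast
    qed
    have "insert a (insert c (insert d {})) \<in> cliques E V (Suc (Suc (Suc 0)))"
      using E e V by (intro insert_clique) (auto simp: cliques_def)
    then have "{a, c, d} \<in> cliques E V (Suc p)" using p2 by (simp add: numeral_2_eq_2)
    moreover have "A \<inter> {a, c, d} = {a}" using A disj by auto
    ultimately show False using A no_bowtie by blast
  qed
qed

end

section \<open>Clique numbers of complete multipartite graphs\<close>

text \<open>The elementary symmetric polynomial of degree \<open>m\<close> in the numbers \<open>a j\<close>. As a coefficient of a product of linear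
factors it visibly depends only on how often each value occurs, which identifies the values for part sizes that agree
up to order.\<close>

definition elem_sym :: "(nat \<Rightarrow> nat) \<Rightarrow> nat set \<Rightarrow> nat \<Rightarrow> nat" where
  "elem_sym a J m = coeff (\<Prod>j\<in>J. [:1, a j:]) m"

lemma elem_sym_0: "elem_sym a J 0 = 1"
  by (simp add: elem_sym_def poly_prod flip: poly_0_coeff_0)

lemma elem_sym_empty_Suc: "elem_sym a {} (Suc m) = 0"
  by (simp add: elem_sym_def)

lemma elem_sym_insert_Suc:
  "\<lbrakk>finite J; j \<notin> J\<rbrakk> \<Longrightarrow> elem_sym a (insert j J) (Suc m) = elem_sym a J (Suc m) + a j * elem_sym a J m"
  by (simp add: elem_sym_def mult_pCons_left)

lemma elem_sym_cong: "\<lbrakk>\<And>j. j \<in> J \<Longrightarrow> a j = b j\<rbrakk> \<Longrightarrow> elem_sym a J m = elem_sym b J m"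
  by (simp add: elem_sym_def cong: prod.cong)

text \<open>Cliques of a complete multipartite graph are the partial transversals of its parts. Splitting by whether
the part \<open>j\<close> is used gives the recursion \<open>elem_sym_insert_Suc\<close>.\<close>

lemma card_multipartite_cliques:
  assumes fin: "finite V" and "finite J"
  shows "card (cliques (\<lambda>u v. g u \<noteq> g v) {v \<in> V. g v \<in> J} m) = elem_sym (\<lambda>j. card {v \<in> V. g v = j}) J m"
  using assms(2)
proof (induction J arbitrary: m rule: finite_induct)
  case empty
  then show ?case
  proof (cases m)
    case 0
    then show ?thesis by (simp add: elem_sym_0 card_cliques_0)
  next
    case (Suc i)
    then have "cliques (\<lambda>u v. g u \<noteq> g v) {v \<in> V. g v \<in> {}} m = {}" by (auto simp: cliques_def)
    then show ?thesis using Suc by (simp add: elem_sym_empty_Suc)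
  qed
next
  case (insert j J)
  let ?C = "\<lambda>J m. cliques (\<lambda>u v. g u \<noteq> g v) {v \<in> V. g v \<in> J} m"
  have finS: "finite S" if "S \<in> ?C K i" for S K i
    using that fin by (auto simp: cliques_def intro: finite_subset[of S V])
  show ?case
  proof (cases m)
    case 0
    then show ?thesis using fin by (simp add: elem_sym_0 card_cliques_0)
  next
    case (Suc i)
    let ?P = "{v \<in> V. g v = j} \<times> ?C J i"
    let ?f = "\<lambda>(v, S). insert v S"
    have dis: "v \<notin> S" if "g v = j" "S \<in> ?C J i" for v S i
      using that insert.hyps by (auto simp: cliques_def)
    have inj: "inj_on ?f ?P"
    proof (rule inj_onI)
      fix x y assume xy: "x \<in> ?P" "y \<in> ?P" "?f x = ?f y"
      obtain v S v' S' where [simp]: "x = (v, S)" "y = (v', S')" by (cases x, cases y) auto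
      have 1: "S \<in> ?C J i" "S' \<in> ?C J i" "g v = j" "g v' = j" and eq: "insert v S = insert v' S'"
        using xy by auto
      have "v' = v"
      proof (rule ccontr)
        assume "v' \<noteq> v"
        then have "v' \<in> S" using eq by auto
        then show False using dis[of v' S i] 1 by simp
      qed
      moreover have "v \<notin> S" "v' \<notin> S'" using dis 1 by auto
      ultimately show "x = y" using eq by (auto simp: insert_ident)
    qed
    have un: "?C (insert j J) (Suc i) = ?C J (Suc i) \<union> ?f ` ?P"
    proof (intro equalityI subsetI)
      fix S assume S: "S \<in> ?C (insert j J) (Suc i)"
      show "S \<in> ?C J (Suc i) \<union> ?f ` ?P"
      proof (cases "\<exists>v\<in>S. g v = j")
        case True
        then obtain v where v: "v \<in> S" "g v = j" by blast
        then have "S - {v} \<in> ?C J i" using S finS[OF S] by (auto simp: cliques_def)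
        moreover have "S = ?f (v, S - {v})" using v by auto
        moreover have "v \<in> V" using S v by (auto simp: cliques_def)
        ultimately show ?thesis using v by blast
      next
        case False
        then show ?thesis using S by (auto simp: cliques_def)
      qed
    next
      fix S assume "S \<in> ?C J (Suc i) \<union> ?f ` ?P"
      then show "S \<in> ?C (insert j J) (Suc i)"
      proof (elim UnE)
        assume "S \<in> ?C J (Suc i)" then show ?thesis by (auto simp: cliques_def)
      next
        assume "S \<in> ?f ` ?P"
        then obtain v T where vT: "S = insert v T" "v \<in> V" "g v = j" "T \<in> ?C J i" by auto
        then show ?thesis using dis[of v T i] finS[of T J i] insert.hyps by (auto simp: cliques_def)
      qed
    qed
    have disj: "?C J (Suc i) \<inter> ?f ` ?P = {}" using insert.hyps by (auto simp: cliques_def)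
    have "card (?C (insert j J) (Suc i)) = card (?C J (Suc i)) + card (?f ` ?P)"
      unfolding un
      by (intro card_Un_disjoint disj finite_imageI finite_cartesian_product finite_cliques) (use fin in auto)
    also have "card (?f ` ?P) = card {v \<in> V. g v = j} * card (?C J i)"
      using card_image[OF inj] by (simp add: card_cartesian_product)
    finally show ?thesis using insert by (simp add: Suc elem_sym_insert_Suc)
  qed
qed

lemma elem_sym_ge:
  assumes "finite J" "\<And>j. j \<in> J \<Longrightarrow> L \<le> a j"
  shows "(card J choose m) * L ^ m \<le> elem_sym a J m"
  using assms
proof (induction J arbitrary: m rule: finite_induct)
  case empty
  then show ?case by (cases m) (auto simp: elem_sym_0 elem_sym_empty_Suc)
next
  case (insert j J)
  show ?case
  proof (cases m)
    case (Suc i)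
    have 1: "(card J choose Suc i) * L ^ Suc i \<le> elem_sym a J (Suc i)" "(card J choose i) * L ^ i \<le> elem_sym a J i"
      using insert by (simp_all del: power_Suc)
    have "L * ((card J choose i) * L ^ i) \<le> a j * elem_sym a J i"
      using 1(2) insert.prems by (intro mult_le_mono) auto
    then show ?thesis using 1(1) insert.hyps unfolding Suc
      by (simp add: elem_sym_insert_Suc algebra_simps)
  qed (simp add: elem_sym_0)
qed

text \<open>A lower counterpart of \<open>clique_ratio_le\<close>: a partial transversal with \<open>m\<close> elements avoids \<open>card J - m\<close>
parts and has at least \<open>L\<close> extensions into each.\<close>

lemma elem_sym_ratio:
  assumes "finite J" "\<And>j. j \<in> J \<Longrightarrow> L \<le> a j"
  shows "L * (card J - m) * elem_sym a J m \<le> Suc m * elem_sym a J (Suc m)"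
  using assms
proof (induction J arbitrary: m rule: finite_induct)
  case empty
  then show ?case by simp
next
  case (insert j J)
  let ?e = "elem_sym a J"
  have IH: "L * (card J - i) * ?e i \<le> Suc i * ?e (Suc i)" for i using insert by simp
  have La: "L \<le> a j" using insert.prems by simp
  show ?case
  proof (cases m)
    case 0
    have "L * Suc (card J) \<le> elem_sym a J (Suc 0) + a j" using IH[of 0] La by (simp add: elem_sym_0)
    then show ?thesis using 0 insert.hyps by (simp add: elem_sym_0 elem_sym_insert_Suc)
  next
    case (Suc i)
    have "L * (Suc (card J) - m) * ?e m \<le> L * (card J - m) * ?e m + a j * ?e m"
    proof -
      have "L * (Suc (card J) - m) \<le> L * (Suc (card J - m))" by (intro mult_le_mono2) simp
      then have "L * (Suc (card J) - m) \<le> L * (card J - m) + a j" using La by simp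
      from mult_le_mono1[OF this, of "?e m"] show ?thesis by (simp add: add_mult_distrib)
    qed
    also have "\<dots> \<le> Suc m * ?e (Suc m) + a j * ?e m" using IH[of m] by simp
    finally have A: "L * (Suc (card J) - m) * ?e m \<le> Suc m * ?e (Suc m) + a j * ?e m" .
    have B: "L * (Suc (card J) - m) * (a j * ?e i) \<le> m * (a j * ?e m)"
      using mult_le_mono2[OF IH[of i], of "a j"] by (simp only: Suc mult_ac diff_Suc_Suc)
    have "L * (Suc (card J) - m) * (?e m + a j * ?e i) \<le> Suc m * (?e (Suc m) + a j * ?e m)"
      using A B by (simp add: algebra_simps)
    then show ?thesis using insert.hyps by (simp add: Suc elem_sym_insert_Suc)
  qed
qed

lemma elem_sym_insert_mono:
  "\<lbrakk>finite J; j \<notin> J; \<And>i. i \<in> J \<Longrightarrow> a i = b i; a j \<le> b j\<rbrakk> \<Longrightarrow> elem_sym a (insert j J) m \<le> elem_sym b (insert j J) m"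
  by (cases m) (auto simp: elem_sym_0 elem_sym_insert_Suc elem_sym_cong[of J a b] intro!: mult_le_mono1)

lemma elem_sym_two:
  "\<lbrakk>finite R; u \<notin> R; v \<notin> R; u \<noteq> v\<rbrakk> \<Longrightarrow> elem_sym a (insert u (insert v R)) (Suc (Suc m)) =
    elem_sym a R (Suc (Suc m)) + (a u + a v) * elem_sym a R (Suc m) + a u * a v * elem_sym a R m"
  by (simp add: elem_sym_insert_Suc algebra_simps)

text \<open>The number of \<open>k\<close>-cliques (for \<open>k \<ge> 2\<close>) in the complete \<open>p\<close>-partite graph with part sizes \<open>a\<close> and one further edge
inside part \<open>i\<close>: the second summand counts the cliques through that edge.\<close>

definition edge_value :: "(nat \<Rightarrow> nat) \<Rightarrow> nat \<Rightarrow> nat \<Rightarrow> nat \<Rightarrow> nat" where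
  "edge_value a p i k = elem_sym a {..<p} k + elem_sym a ({..<p} - {i}) (k - 2)"

text \<open>Moving a vertex from a large part \<open>u\<close> to a small part \<open>v\<close> raises \<open>a u * a v\<close>, and so gains at least
\<open>elem_sym a R (k - 2)\<close> cliques, where \<open>R\<close> is the set of the other parts. There is a loss only if the extra edge lies
in \<open>v\<close>; it is \<open>elem_sym a R (k - 3)\<close>, which is no larger by \<open>elem_sym_ratio\<close> as the parts have at least \<open>k\<close> vertices.\<close>

lemma edge_value_transfer:
  assumes k: "2 \<le> k" "k \<le> p" and a: "\<And>j. j < p \<Longrightarrow> k \<le> a j"
    and uv: "u < p" "v < p" "a v + 2 \<le> a u"
  shows "edge_value a p i k \<le> edge_value (a(u := a u - 1, v := a v + 1)) p i k"
proof -
  define b where "b = a(u := a u - 1, v := a v + 1)"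
  have ne: "u \<noteq> v" using uv by auto
  have b: "b u = a u - 1" "b v = a v + 1" "\<And>j. j \<noteq> u \<Longrightarrow> j \<noteq> v \<Longrightarrow> b j = a j"
    using ne by (auto simp: b_def)
  define R where "R = {..<p} - {u, v}"
  obtain m where m: "k = Suc (Suc m)" using k by (metis Suc_le_D numeral_2_eq_2 Suc_le_mono)
  have R: "finite R" "u \<notin> R" "v \<notin> R" "{..<p} = insert u (insert v R)" "card R = p - 2"
    using uv ne by (auto simp: R_def card_Diff_subset)
  have bR: "elem_sym b R i = elem_sym a R i" for i using R by (intro elem_sym_cong b(3)) auto
  have bs: "b u + b v = a u + a v" using uv b by simp
  have bp: "a u * a v + 1 \<le> b u * b v"
  proof -
    obtain d where "a u = a v + 2 + d" using uv le_Suc_ex by blast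
    then show ?thesis using b by (simp add: algebra_simps)
  qed
  have two_mono: "elem_sym a (insert u (insert v S)) m \<le> elem_sym b (insert u (insert v S)) m"
    if S: "finite S" "u \<notin> S" "v \<notin> S" for S m
  proof -
    have bS: "elem_sym b S i = elem_sym a S i" for i using S by (intro elem_sym_cong b(3)) auto
    consider "m = 0" | "m = 1" | l where "m = Suc (Suc l)" by (metis One_nat_def not0_implies_Suc)
    then show ?thesis
    proof cases
      case 1 then show ?thesis by (simp add: elem_sym_0)
    next
      case 2 then show ?thesis using S ne bs by (simp add: elem_sym_insert_Suc elem_sym_0 bS)
    next
      case 3
      have "a u * a v * elem_sym a S l \<le> b u * b v * elem_sym a S l" using bp by (intro mult_le_mono1) simp
      then show ?thesis using 3 S ne by (simp add: elem_sym_two bS bs)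
    qed
  qed
  have gain: "elem_sym a {..<p} k + elem_sym a R m \<le> elem_sym b {..<p} k"
  proof -
    have "(a u * a v + 1) * elem_sym a R m \<le> b u * b v * elem_sym a R m" by (rule mult_le_mono1[OF bp])
    then show ?thesis unfolding R(4) m elem_sym_two[OF R(1-3) ne] bR bs by simp
  qed
  have "elem_sym a ({..<p} - {i}) m \<le> elem_sym b ({..<p} - {i}) m + elem_sym a R m"
  proof -
    consider "i = u" | "i = v" | "i \<noteq> u" "i \<noteq> v" by blast
    then show ?thesis
    proof cases
      case 1
      then have "{..<p} - {i} = insert v R" using R ne by auto
      moreover have "elem_sym a (insert v R) m \<le> elem_sym b (insert v R) m"
      proof (rule elem_sym_insert_mono)
        show "a j = b j" if "j \<in> R" for j
        proof -
          have "j \<noteq> u" "j \<noteq> v" using that R(2,3) by auto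
          then show ?thesis by (simp add: b(3))
        qed
      qed (use R b in auto)
      ultimately show ?thesis by simp
    next
      case 2
      then have eq: "{..<p} - {i} = insert u R" using R ne by auto
      show ?thesis
      proof (cases m)
        case 0 then show ?thesis by (simp add: elem_sym_0)
      next
        case (Suc l)
        have "Suc l * elem_sym a R l \<le> k * (card R - l) * elem_sym a R l"
        proof (rule mult_le_mono1)
          have "Suc l \<le> k" "1 \<le> card R - l" using R(5) k m Suc by simp_all
          from mult_le_mono[OF this] show "Suc l \<le> k * (card R - l)" by simp
        qed
        also have "\<dots> \<le> Suc l * elem_sym a R (Suc l)"
          by (rule elem_sym_ratio) (use R a in auto)
        finally have "elem_sym a R l \<le> elem_sym a R (Suc l)" by (simp only: Suc_mult_le_cancel1)
        moreover have "a u * elem_sym a R l = b u * elem_sym a R l + elem_sym a R l"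
        proof -
          have "a u = b u + 1" using b uv by simp
          then show ?thesis by (simp add: algebra_simps)
        qed
        ultimately show ?thesis unfolding eq Suc using R by (simp add: elem_sym_insert_Suc bR)
      qed
    next
      case 3
      then have eq: "{..<p} - {i} = insert u (insert v (R - {i}))" using R ne by auto
      show ?thesis unfolding eq using two_mono[of "R - {i}" m] R by simp
    qed
  qed
  moreover have "k - 2 = m" using m by simp
  ultimately show ?thesis
    using gain unfolding edge_value_def b_def[symmetric] by simp
qed

text \<open>Balanced part sizes take two consecutive values, so their symmetric polynomials depend only on the two
multiplicities.\<close>

lemma elem_sym_two_valued:
  assumes "finite J" "\<And>j. j \<in> J \<Longrightarrow> a j = q \<or> a j = q + 1"
  shows "elem_sym a J m = coeff ([:1, q + 1:] ^ card {j \<in> J. a j = q + 1} * [:1, q:] ^ card {j \<in> J. a j = q}) m"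
proof -
  have J: "J = {j \<in> J. a j = q + 1} \<union> {j \<in> J. a j = q}" using assms by auto
  have "(\<Prod>j\<in>J. [:1, a j:]) = (\<Prod>j | j \<in> J \<and> a j = q + 1. [:1, a j:]) * (\<Prod>j | j \<in> J \<and> a j = q. [:1, a j:])"
    by (subst J, rule prod.union_disjoint) (use assms in auto)
  also have "\<dots> = [:1, q + 1:] ^ card {j \<in> J. a j = q + 1} * [:1, q:] ^ card {j \<in> J. a j = q}"
    by simp
  finally show ?thesis by (simp add: elem_sym_def)
qed

lemma sum_two_valued:
  fixes a :: "nat \<Rightarrow> nat"
  assumes "finite J" "\<And>j. j \<in> J \<Longrightarrow> a j = q \<or> a j = q + 1"
  shows "sum a J = q * card J + card {j \<in> J. a j = q + 1}" 
    "card J = card {j \<in> J. a j = q + 1} + card {j \<in> J. a j = q}"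
proof -
  have J: "J = {j \<in> J. a j = q + 1} \<union> {j \<in> J. a j = q}" using assms by auto
  show c: "card J = card {j \<in> J. a j = q + 1} + card {j \<in> J. a j = q}"
    by (subst J, rule card_Un_disjoint) (use assms in auto)
  have "sum a J = sum a {j \<in> J. a j = q + 1} + sum a {j \<in> J. a j = q}"
    by (subst J, rule sum.union_disjoint) (use assms in auto)
  also have "\<dots> = (q + 1) * card {j \<in> J. a j = q + 1} + q * card {j \<in> J. a j = q}" by simp
  finally show "sum a J = q * card J + card {j \<in> J. a j = q + 1}" unfolding c by (simp add: algebra_simps)
qed

definition turan_sizes :: "nat \<Rightarrow> nat \<Rightarrow> nat \<Rightarrow> nat" where
  "turan_sizes n p i = n div p + (if i < n mod p then 1 else 0)"

text \<open>Balanced sizes agree with those of the Turan graph up to order, and the extra edge is worth most in a smallest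
part, since then the largest parts remain for completing it to a clique.\<close>

lemma edge_value_balanced:
  assumes p: "0 < p" and a: "\<And>u v. \<lbrakk>u < p; v < p\<rbrakk> \<Longrightarrow> a u \<le> a v + 1" and i: "i < p"
  shows "edge_value a p i k \<le> edge_value (turan_sizes (sum a {..<p}) p) p (p - 1) k"
proof -
  define q where "q = Min (a ` {..<p})"
  define n where "n = sum a {..<p}"
  let ?b = "turan_sizes n p"
  have ne: "a ` {..<p} \<noteq> {}" using p by auto
  have "q \<in> a ` {..<p}" unfolding q_def by (rule Min_in) (use ne in auto)
  then obtain j0 where j0: "j0 < p" "a j0 = q" by auto
  have aq: "a j = q \<or> a j = q + 1" if "j \<in> {..<p}" for j
  proof -
    have "q \<le> a j" using that by (simp add: q_def)
    moreover have "a j \<le> q + 1" using a[of j j0] that j0 by simp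
    ultimately show ?thesis by auto
  qed
  define c where "c = card {j \<in> {..<p}. a j = q + 1}"
  have cp: "p = c + card {j \<in> {..<p}. a j = q}" and n: "n = q * p + c"
    using sum_two_valued[of "{..<p}" a q] aq by (auto simp: c_def n_def)
  have "card {j \<in> {..<p}. a j = q} \<noteq> 0" using j0 by auto
  then have "c < p" using cp by linarith
  then have nq: "n div p = q" "n mod p = c" using n by auto
  have bq: "?b j = q \<or> ?b j = q + 1" for j by (simp add: turan_sizes_def nq)
  have "{j \<in> {..<p}. ?b j = q + 1} = {..<c}" "{j \<in> {..<p}. ?b j = q} = {c..<p}"
    using \<open>c < p\<close> by (auto simp: turan_sizes_def nq)
  then have "elem_sym ?b {..<p} k = coeff ([:1, q + 1:] ^ c * [:1, q:] ^ (p - c)) k"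
    using elem_sym_two_valued[of "{..<p}" ?b q k] bq by simp
  moreover have "elem_sym a {..<p} k = coeff ([:1, q + 1:] ^ c * [:1, q:] ^ (p - c)) k"
  proof -
    have "card {j \<in> {..<p}. a j = q} = p - c" using cp by linarith
    then show ?thesis using elem_sym_two_valued[OF finite_lessThan aq] by (simp only: c_def)
  qed
  moreover have "elem_sym ?b ({..<p} - {p - 1}) m = coeff ([:1, q + 1:] ^ c * [:1, q:] ^ (p - c - 1)) m" for m
  proof -
    have "{j \<in> {..<p} - {p - 1}. ?b j = q + 1} = {..<c}" "{j \<in> {..<p} - {p - 1}. ?b j = q} = {c..<p - 1}"
      using \<open>c < p\<close> by (auto simp: turan_sizes_def nq)
    then show ?thesis using elem_sym_two_valued[of "{..<p} - {p - 1}" ?b q m] bq by (simp add: diff_commute)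
  qed
  moreover have "elem_sym a ({..<p} - {i}) m \<le> coeff ([:1, q + 1:] ^ c * [:1, q:] ^ (p - c - 1)) m" for m
  proof (cases "a i = q")
    case True
    then have 1: "{j \<in> {..<p} - {i}. a j = q + 1} = {j \<in> {..<p}. a j = q + 1}" 
      "{j \<in> {..<p} - {i}. a j = q} = {j \<in> {..<p}. a j = q} - {i}" by auto
    have "card {j \<in> {..<p} - {i}. a j = q} = p - c - 1"
      unfolding 1(2) using True i cp by (subst card_Diff_singleton) auto
    then show ?thesis using elem_sym_two_valued[of "{..<p} - {i}" a q m] aq 1(1) by (simp add: c_def)
  next
    case False
    then have ai: "a i = q + 1" using aq i by auto
    then have 1: "{j \<in> {..<p} - {i}. a j = q + 1} = {j \<in> {..<p}. a j = q + 1} - {i}" 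
      "{j \<in> {..<p} - {i}. a j = q} = {j \<in> {..<p}. a j = q}" by auto
    have "card {j \<in> {..<p} - {i}. a j = q + 1} = c - 1"
      unfolding 1(1) using ai i by (subst card_Diff_singleton) (auto simp: c_def)
    then have e: "elem_sym a ({..<p} - {i}) m = coeff ([:1, q + 1:] ^ (c - 1) * [:1, q:] ^ (p - c)) m"
    proof -
      have "card {j \<in> {..<p}. a j = q} = p - c" using cp by linarith
      moreover have "a j = q \<or> a j = q + 1" if "j \<in> {..<p} - {i}" for j using aq that by blast
      ultimately show ?thesis
        using elem_sym_two_valued[of "{..<p} - {i}" a q m]
          \<open>card {j \<in> {..<p} - {i}. a j = q + 1} = c - 1\<close> unfolding 1(2) by simp
    qed
    have "c > 0" using ai i unfolding c_def by (subst card_gt_0_iff) auto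
    define P where "P = [:1, q + 1:] ^ (c - 1) * [:1, q:] ^ (p - c - 1)"
    have "[:1, q:] ^ (p - c) = [:1, q:] * [:1, q:] ^ (p - c - 1)"
      using \<open>c < p\<close> by (metis power_Suc Suc_diff_1 zero_less_diff)
    then have "[:1, q + 1:] ^ (c - 1) * [:1, q:] ^ (p - c) = [:1, q:] * P" by (simp only: P_def mult_ac)
    moreover have "[:1, q + 1:] ^ c = [:1, q + 1:] * [:1, q + 1:] ^ (c - 1)"
      using \<open>c > 0\<close> by (metis power_Suc Suc_diff_1)
    then have "[:1, q + 1:] ^ c * [:1, q:] ^ (p - c - 1) = [:1, q + 1:] * P" by (simp only: P_def mult_ac)
    moreover have "coeff ([:1, q:] * P) m \<le> coeff ([:1, q + 1:] * P) m"
      by (cases m) (auto simp: mult_pCons_left)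
    ultimately show ?thesis unfolding e by simp
  qed
  ultimately show ?thesis unfolding edge_value_def n_def[symmetric] by simp
qed

text \<open>Transfers from larger to smaller parts decrease the sum of the squares, so they end in a balanced
configuration.\<close>

theorem edge_value_le_turan:
  assumes k: "2 \<le> k" "k \<le> p" and "\<And>j. j < p \<Longrightarrow> k \<le> a j" and i: "i < p"
  shows "edge_value a p i k \<le> edge_value (turan_sizes (sum a {..<p}) p) p (p - 1) k"
  using assms(3)
proof (induction "\<Sum>j<p. (a j)\<^sup>2" arbitrary: a rule: less_induct)
  case less
  have p: "0 < p" using k by simp
  show ?case
  proof (cases "\<forall>u<p. \<forall>v<p. a u \<le> a v + 1")
    case True
    then show ?thesis using edge_value_balanced[OF p _ i] by blast
  next
    case False
    then obtain u v where uv: "u < p" "v < p" "a v + 2 \<le> a u" by force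
    define b where "b = a(u := a u - 1, v := a v + 1)"
    have ne: "u \<noteq> v" using uv by auto
    have b: "b u = a u - 1" "b v = a v + 1" "\<And>j. j \<noteq> u \<Longrightarrow> j \<noteq> v \<Longrightarrow> b j = a j"
      using ne by (auto simp: b_def)
    define R where "R = {..<p} - {u, v}"
    have R: "finite R" "u \<notin> R" "v \<notin> R" "{..<p} = insert u (insert v R)"
      using uv by (auto simp: R_def)
    have Rb: "(\<Sum>j\<in>R. (b j)\<^sup>2) = (\<Sum>j\<in>R. (a j)\<^sup>2)" "sum b R = sum a R"
    proof -
      have "b j = a j" if "j \<in> R" for j using that R(2,3) by (intro b(3)) auto
      then show "(\<Sum>j\<in>R. (b j)\<^sup>2) = (\<Sum>j\<in>R. (a j)\<^sup>2)" "sum b R = sum a R" by simp_all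
    qed
    have "(b u)\<^sup>2 + (b v)\<^sup>2 < (a u)\<^sup>2 + (a v)\<^sup>2"
    proof -
      obtain d where "a u = a v + 2 + d" using uv le_Suc_ex by blast
      then show ?thesis using b by (simp add: power2_eq_square algebra_simps)
    qed
    then have "(\<Sum>j<p. (b j)\<^sup>2) < (\<Sum>j<p. (a j)\<^sup>2)"
      unfolding R(4) using R ne Rb by simp
    moreover have "k \<le> b j" if "j < p" for j
      using less.prems[OF that] less.prems[OF uv(2)] uv by (auto simp: b_def)
    ultimately have "edge_value b p i k \<le> edge_value (turan_sizes (sum b {..<p}) p) p (p - 1) k"
      using less.hyps by blast
    moreover have "sum b {..<p} = sum a {..<p}" unfolding R(4) using R ne Rb b uv by simp
    moreover have "edge_value a p i k \<le> edge_value b p i k"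
      unfolding b_def by (rule edge_value_transfer[OF k less.prems uv])
    ultimately show ?thesis by simp
  qed
qed

section \<open>Translation to labelled subgraphs and the extremal graph\<close>

abbreviation adj :: "'a graph \<Rightarrow> 'a \<Rightarrow> 'a \<Rightarrow> bool" where
  "adj G u v \<equiv> {u, v} \<in> edges G"

lemma adj_irrefl: "simple_graph G \<Longrightarrow> \<not> adj G u u"
  by (auto simp: simple_graph_def)

lemma complete_edges_iff: "{u, v} \<in> complete_edges A \<longleftrightarrow> u \<in> A \<and> v \<in> A \<and> u \<noteq> v"
  by (auto simp: complete_edges_def card_insert_if)

lemma num_copies_complete_graph:
  assumes G: "simple_graph G"
  shows "num_copies (complete_graph k) G = card (cliques (adj G) (verts G) k)"
proof -
  have fin: "finite (verts G)" using G by (simp add: simple_graph_def)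
  have "copies (complete_graph k) G = (\<lambda>A. (A, complete_edges A)) ` cliques (adj G) (verts G) k"
  proof (intro equalityI subsetI)
    fix S assume S: "S \<in> copies (complete_graph k) G"
    then have sub: "simple_graph S" "verts S \<subseteq> verts G" "edges S \<subseteq> edges G"
      and "isomorphic (complete_graph k) S" by (auto simp: copies_def subgraph_def)
    then obtain f where f: "bij_betw f {..<k} (verts S)"
      "\<forall>u\<in>{..<k}. \<forall>v\<in>{..<k}. {u, v} \<in> complete_edges {..<k} \<longleftrightarrow> {f u, f v} \<in> edges S"
      by (auto simp: isomorphic_def complete_graph_def)
    have c: "card (verts S) = k" using bij_betw_same_card[OF f(1)] by simp
    have E: "{x, y} \<in> edges S" if "x \<in> verts S" "y \<in> verts S" "x \<noteq> y" for x y
    proof -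
      have "x \<in> f ` {..<k}" "y \<in> f ` {..<k}" using that f(1) by (simp_all add: bij_betw_def)
      then obtain u v where "u < k" "v < k" "f u = x" "f v = y" by auto
      then show ?thesis using f(2) that by (auto simp: complete_edges_iff)
    qed
    have "edges S = complete_edges (verts S)"
    proof (intro equalityI subsetI)
      fix e assume "e \<in> edges S"
      then show "e \<in> complete_edges (verts S)" using sub(1) by (auto simp: simple_graph_def complete_edges_def)
    next
      fix e assume "e \<in> complete_edges (verts S)"
      then show "e \<in> edges S" using E by (auto simp: complete_edges_def card_2_iff)
    qed
    then have "S = (verts S, complete_edges (verts S))" by (metis prod.collapse)
    moreover have "verts S \<in> cliques (adj G) (verts G) k"
      using c E sub by (auto simp: cliques_def)
    ultimately show "S \<in> (\<lambda>A. (A, complete_edges A)) ` cliques (adj G) (verts G) k" by blast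
  next
    fix S assume "S \<in> (\<lambda>A. (A, complete_edges A)) ` cliques (adj G) (verts G) k"
    then obtain A where A: "S = (A, complete_edges A)" "A \<subseteq> verts G" "card A = k"
      "\<And>u v. \<lbrakk>u \<in> A; v \<in> A; u \<noteq> v\<rbrakk> \<Longrightarrow> {u, v} \<in> edges G" by (auto simp: cliques_def)
    have fA: "finite A" using A fin finite_subset by blast
    then obtain f where f: "bij_betw f {..<k} A"
      using A(3) by (metis finite_lessThan card_lessThan finite_same_card_bij)
    have "isomorphic (complete_graph k) S"
      unfolding isomorphic_def complete_graph_def A(1)
    proof (intro exI[of _ f] conjI ballI)
      show "bij_betw f (verts ({..<k}, complete_edges {..<k})) (verts (A, complete_edges A))" using f by simp
      fix u v assume "u \<in> verts ({..<k}, complete_edges {..<k})" "v \<in> verts ({..<k}, complete_edges {..<k})"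
      then have uv: "u \<in> {..<k}" "v \<in> {..<k}" by simp_all
      have "f u \<in> A" "f v \<in> A" "f u = f v \<longleftrightarrow> u = v"
        using uv f by (auto simp: bij_betw_def inj_on_eq_iff)
      then show "{u, v} \<in> edges ({..<k}, complete_edges {..<k}) \<longleftrightarrow> {f u, f v} \<in> edges (A, complete_edges A)"
        using uv by (auto simp: complete_edges_iff)
    qed
    moreover have "subgraph S G"
      using A fA by (auto simp: subgraph_def simple_graph_def complete_edges_def card_2_iff)
    ultimately show "S \<in> copies (complete_graph k) G" by (simp add: copies_def)
  qed
  moreover have "inj_on (\<lambda>A. (A, complete_edges A)) (cliques (adj G) (verts G) k)" by (rule inj_onI) simp
  ultimately show ?thesis by (simp only: num_copies_def card_image)
qed

text \<open>Two \<open>r\<close>-cliques \<open>A\<close> and \<open>B\<close> with one common vertex \<open>x\<close> are a copy of \<open>B\<^bsub>r,1\<^esub>\<close>. The isomorphism is glued from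
bijections onto \<open>A - {x}\<close>, \<open>{x}\<close> and \<open>B - {x}\<close>.\<close>

lemma bowtie_free_if_free_of:
  assumes G: "simple_graph G" and r: "1 \<le> r" and free: "free_of (B1_graph r) G"
  shows "bowtie_free (adj G) (verts G) r"
  unfolding bowtie_free_def
proof (intro ballI notI)
  fix A B assume AB: "A \<in> cliques (adj G) (verts G) r" "B \<in> cliques (adj G) (verts G) r" "card (A \<inter> B) = 1"
  then obtain x where x: "A \<inter> B = {x}" by (auto simp: card_1_singleton_iff)
  have fin: "finite A" "finite B" "card A = r" "card B = r"
    using AB G by (auto simp: cliques_def simple_graph_def intro: finite_subset)
  have "card {..<r - 1} = card (A - {x})" "card {r..<2 * r - 1} = card (B - {x})"
  proof -
    have "x \<in> A" "x \<in> B" using x by auto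
    then show "card {..<r - 1} = card (A - {x})" "card {r..<2 * r - 1} = card (B - {x})"
      by (simp_all add: fin card_Diff_singleton)
  qed
  then obtain f1 f2 where f1: "bij_betw f1 {..<r - 1} (A - {x})" and f2: "bij_betw f2 {r..<2 * r - 1} (B - {x})"
    using fin finite_same_card_bij[of "{..<r - 1}" "A - {x}"] finite_same_card_bij[of "{r..<2 * r - 1}" "B - {x}"]
    by auto
  define f where "f i = (if i < r - 1 then f1 i else if i = r - 1 then x else f2 i)" for i
  have 1: "bij_betw f {..<r - 1} (A - {x})" using f1 by (subst bij_betw_cong[of _ f f1]) (auto simp: f_def)
  have 2: "bij_betw f {r - 1} {x}" by (auto simp: f_def bij_betw_def)
  have 3: "bij_betw f {r..<2 * r - 1} (B - {x})"
    using f2 r by (subst bij_betw_cong[of _ f f2]) (auto simp: f_def)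
  have "bij_betw f ({..<r - 1} \<union> {r - 1}) ((A - {x}) \<union> {x})"
    by (rule bij_betw_combine[OF 1 2]) auto
  moreover have "{..<r - 1} \<union> {r - 1} = {..<r}" "(A - {x}) \<union> {x} = A" using r x by auto
  ultimately have fA: "bij_betw f {..<r} A" by simp
  have "bij_betw f ({r - 1} \<union> {r..<2 * r - 1}) ({x} \<union> (B - {x}))"
    by (rule bij_betw_combine[OF 2 3]) auto
  moreover have "{r - 1} \<union> {r..<2 * r - 1} = {r - 1..<2 * r - 1}" "{x} \<union> (B - {x}) = B" using r x by auto
  ultimately have fB: "bij_betw f {r - 1..<2 * r - 1} B" by simp
  have "bij_betw f ({..<r} \<union> {r..<2 * r - 1}) (A \<union> (B - {x}))"
    by (rule bij_betw_combine[OF fA 3]) (use x in auto)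
  moreover have "{..<r} \<union> {r..<2 * r - 1} = {..<2 * r - 1}" "A \<union> (B - {x}) = A \<union> B" using r x by auto
  ultimately have fAB: "bij_betw f {..<2 * r - 1} (A \<union> B)" by simp
  have mem: "f i \<in> A \<longleftrightarrow> i \<in> {..<r}" "f i \<in> B \<longleftrightarrow> i \<in> {r - 1..<2 * r - 1}" if "i < 2 * r - 1" for i
  proof -
    have inj: "f i = f j \<longleftrightarrow> i = j" if "j < 2 * r - 1" for j
      using fAB that \<open>i < 2 * r - 1\<close> by (auto simp: bij_betw_def inj_on_eq_iff)
    have "A = f ` {..<r}" "B = f ` {r - 1..<2 * r - 1}" using fA fB by (auto simp: bij_betw_def)
    then show "f i \<in> A \<longleftrightarrow> i \<in> {..<r}" "f i \<in> B \<longleftrightarrow> i \<in> {r - 1..<2 * r - 1}"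
      using inj r by (auto simp: image_iff)
  qed
  define S where "S = (A \<union> B, complete_edges A \<union> complete_edges B)"
  have "isomorphic (B1_graph r) S"
    unfolding isomorphic_def B1_graph_def S_def
  proof (intro exI[of _ f] conjI ballI; simp only: fst_conv snd_conv)
    show "bij_betw f {..<2 * r - 1} (A \<union> B)" by (rule fAB)
    fix u v assume uv: "u \<in> {..<2 * r - 1}" "v \<in> {..<2 * r - 1}"
    have "f u = f v \<longleftrightarrow> u = v" using fAB uv by (auto simp: bij_betw_def inj_on_eq_iff)
    then show "{u, v} \<in> complete_edges {..<r} \<union> complete_edges {r - 1..<2 * r - 1} \<longleftrightarrow>
      {f u, f v} \<in> complete_edges A \<union> complete_edges B"
      using mem uv by (simp add: complete_edges_iff)
  qed
  moreover have "subgraph S G"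
    using AB fin by (auto simp: S_def subgraph_def simple_graph_def cliques_def complete_edges_def card_2_iff)
  ultimately show False using free unfolding free_of_def by blast
qed

lemma free_of_if_bowtie_free:
  assumes G: "simple_graph G" and r: "1 \<le> r" and bf: "bowtie_free (adj G) (verts G) r"
  shows "free_of (B1_graph r) G"
  unfolding free_of_def
proof (intro notI, elim exE conjE)
  fix S assume S: "subgraph S G" "isomorphic (B1_graph r) S"
  then obtain f where f: "bij_betw f {..<2 * r - 1} (verts S)"
    "\<And>u v. \<lbrakk>u < 2 * r - 1; v < 2 * r - 1; {u, v} \<in> complete_edges {..<r} \<union> complete_edges {r - 1..<2 * r - 1}\<rbrakk>
      \<Longrightarrow> {f u, f v} \<in> edges S"
    by (auto simp: isomorphic_def B1_graph_def)
  have inj: "inj_on f {..<2 * r - 1}" and im: "f ` {..<2 * r - 1} = verts S" using f(1) by (auto simp: bij_betw_def)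
  have sub: "verts S \<subseteq> verts G" "edges S \<subseteq> edges G" using S by (auto simp: subgraph_def)
  have cl: "f ` I \<in> cliques (adj G) (verts G) r"
    if I: "I = {..<r} \<or> I = {r - 1..<2 * r - 1}" for I
  proof -
    have sI: "I \<subseteq> {..<2 * r - 1}" "card I = r" using I r by auto
    have "card (f ` I) = r" using card_image[OF inj_on_subset[OF inj sI(1)]] sI by simp
    moreover have "{f u, f v} \<in> edges G" if "u \<in> I" "v \<in> I" "f u \<noteq> f v" for u v
    proof -
      have "u < 2 * r - 1" "v < 2 * r - 1" using that sI by auto
      moreover have "{u, v} \<in> complete_edges {..<r} \<union> complete_edges {r - 1..<2 * r - 1}"
        using that I by (auto simp: complete_edges_iff)
      ultimately show ?thesis using f(2) sub by blast
    qed
    moreover have "f ` I \<subseteq> verts G" using im sI sub by blast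
    ultimately show ?thesis by (auto simp: cliques_def)
  qed
  have "f ` {..<r} \<inter> f ` {r - 1..<2 * r - 1} = f ` ({..<r} \<inter> {r - 1..<2 * r - 1})"
    by (rule inj_on_image_Int[OF inj, symmetric]) (use r in auto)
  also have "{..<r} \<inter> {r - 1..<2 * r - 1} = {r - 1}" using r by auto
  finally have "card (f ` {..<r} \<inter> f ` {r - 1..<2 * r - 1}) = 1" by simp
  then show False using bf cl unfolding bowtie_free_def by blast
qed

lemma card_add_le_card:
  assumes "finite C" "A \<subseteq> C" "B \<subseteq> C" "A \<inter> B = {}"
  shows "card A + card B \<le> card C"
proof -
  have "finite A" "finite B" using assms finite_subset by blast+
  then have "card A + card B = card (A \<union> B)" using assms by (simp add: card_Un_disjoint)
  also have "\<dots> \<le> card C" using assms by (intro card_mono) auto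
  finally show ?thesis .
qed

lemma multipartite_plus_edge_cliques:
  assumes fin: "finite V" and xy: "x \<in> V" "y \<in> V" "x \<noteq> y" "g x = g y" "E x y" "E y x"
    and E: "\<And>u v. \<lbrakk>u \<in> V; v \<in> V; g u \<noteq> g v\<rbrakk> \<Longrightarrow> E u v" and k: "2 \<le> k"
  shows "card (cliques (\<lambda>u v. g u \<noteq> g v) V k) + card (cliques (\<lambda>u v. g u \<noteq> g v) {v \<in> V. g v \<noteq> g x} (k - 2))
    \<le> card (cliques E V k)"
proof -
  let ?A = "cliques (\<lambda>u v. g u \<noteq> g v) V k" and ?B = "cliques (\<lambda>u v. g u \<noteq> g v) {v \<in> V. g v \<noteq> g x} (k - 2)"
  let ?f = "\<lambda>S. insert x (insert y S)"
  have nB: "x \<notin> S" "y \<notin> S" if "S \<in> ?B" for S using that xy by (auto simp: cliques_def)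
  have inj: "inj_on ?f ?B"
  proof (rule inj_onI)
    fix S T assume ST: "S \<in> ?B" "T \<in> ?B" "?f S = ?f T"
    have "S = ?f S - {x, y}" "T = ?f T - {x, y}" using nB[OF ST(1)] nB[OF ST(2)] by auto
    then show "S = T" using ST(3) by simp
  qed
  have "?A \<subseteq> cliques E V k" using E by (auto simp: cliques_def subset_iff)
  moreover have "?f ` ?B \<subseteq> cliques E V k"
  proof clarify
    fix S assume S: "S \<in> ?B"
    have "finite S" using S fin by (auto simp: cliques_def intro: finite_subset[of S V])
    have SV: "S \<subseteq> V" "card S = k - 2" using S by (auto simp: cliques_def)
    have gS: "g s \<noteq> g x" "g s \<noteq> g y" if "s \<in> S" for s
      using S that xy by (auto simp: cliques_def)
    have c: "card (?f S) = k" using nB[OF S] SV \<open>finite S\<close> xy k by simp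
    have "E u v" if uv: "u \<in> ?f S" "v \<in> ?f S" "u \<noteq> v" for u v
    proof -
      consider "u \<in> {x, y}" "v \<in> {x, y}" | "u \<in> S" "v \<in> S" | "u \<in> {x, y}" "v \<in> S" | "u \<in> S" "v \<in> {x, y}"
        using uv by blast
      then show ?thesis
      proof cases
        case 1 then show ?thesis using uv xy by auto
      next
        case 2 then show ?thesis using uv S SV by (intro E) (auto simp: cliques_def)
      next
        case 3
        have "g u \<noteq> g v" "u \<in> V" using 3 gS[of v] xy by auto
        then show ?thesis using 3 SV by (intro E) auto
      next
        case 4
        have "g u \<noteq> g v" "v \<in> V" using 4 gS[of u] xy by auto
        then show ?thesis using 4 SV by (intro E) auto
      qed
    qed
    then show "?f S \<in> cliques E V k" using c SV xy by (auto simp: cliques_def)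
  qed
  moreover have "?A \<inter> ?f ` ?B = {}" using xy by (auto simp: cliques_def)
  ultimately have "card ?A + card (?f ` ?B) \<le> card (cliques E V k)"
    by (intro card_add_le_card finite_cliques fin)
  then show ?thesis by (simp add: card_image[OF inj])
qed

lemma adj_turan_plus:
  "adj (turan_plus n p) u v \<longleftrightarrow> u < n \<and> v < n \<and> u mod p \<noteq> v mod p \<or> {u, v} = {p - 1, 2 * p - 1}"
  by (auto simp: turan_plus_def turan_def complete_multipartite_def doubleton_eq_iff)

lemma verts_turan_plus: "verts (turan_plus n p) = {..<n}"
  by (simp add: turan_plus_def turan_def complete_multipartite_def)

lemma card_residue_class: "j < p \<Longrightarrow> card {v \<in> {..<n}. v mod p = j} = turan_sizes n p j"
  using card_turan_part[of j p n] by (simp add: turan_part_def turan_sizes_def)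

lemma card_cliques_turan:
  assumes "J \<subseteq> {..<p}"
  shows "card (cliques (\<lambda>u v. u mod p \<noteq> v mod p) {v \<in> {..<n}. v mod p \<in> J} m) = elem_sym (turan_sizes n p) J m"
proof -
  have "finite J" using assms finite_subset by blast
  then have "card (cliques (\<lambda>u v. u mod p \<noteq> v mod p) {v \<in> {..<n}. v mod p \<in> J} m)
    = elem_sym (\<lambda>j. card {v \<in> {..<n}. v mod p = j}) J m"
    by (intro card_multipartite_cliques) auto
  also have "\<dots> = elem_sym (turan_sizes n p) J m"
    using assms card_residue_class[of _ p n] by (intro elem_sym_cong) auto
  finally show ?thesis .
qed

lemma edge_value_le_turan_plus:
  assumes p: "0 < p" "2 * p \<le> n" and k: "2 \<le> k"
  shows "edge_value (turan_sizes n p) p (p - 1) k \<le> card (cliques (adj (turan_plus n p)) {..<n} k)"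
proof -
  have e: "(2 * p - 1) mod p = p - 1"
  proof -
    have "2 * p - 1 = (p - 1) + p" using p by simp
    moreover have "((p - 1) + p) mod p = p - 1" unfolding mod_add_self2 using p by simp
    ultimately show ?thesis by simp
  qed
  have "elem_sym (turan_sizes n p) {..<p} k = card (cliques (\<lambda>u v. u mod p \<noteq> v mod p) {..<n} k)"
    using card_cliques_turan[of "{..<p}" p n k] p by (simp add: Collect_conv_if lessThan_def)
  moreover have "elem_sym (turan_sizes n p) ({..<p} - {p - 1}) (k - 2) =
    card (cliques (\<lambda>u v. u mod p \<noteq> v mod p) {v \<in> {..<n}. v mod p \<noteq> (p - 1) mod p} (k - 2))"
    using card_cliques_turan[of "{..<p} - {p - 1}" p n "k - 2"] p by simp
  moreover have "card (cliques (\<lambda>u v. u mod p \<noteq> v mod p) {..<n} k) +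
    card (cliques (\<lambda>u v. u mod p \<noteq> v mod p) {v \<in> {..<n}. v mod p \<noteq> (p - 1) mod p} (k - 2))
      \<le> card (cliques (adj (turan_plus n p)) {..<n} k)"
    by (rule multipartite_plus_edge_cliques[where y = "2 * p - 1"])
      (use p k e in \<open>auto simp: adj_turan_plus\<close>)
  ultimately show ?thesis by (simp add: edge_value_def)
qed

lemma turan_plus_cliques_ge:
  assumes p: "0 < p" "2 * p \<le> n" and k: "2 \<le> k"
  shows "(p choose k) * (n div p) ^ k \<le> card (cliques (adj (turan_plus n p)) {..<n} k)"
proof -
  have "(card {..<p} choose k) * (n div p) ^ k \<le> elem_sym (turan_sizes n p) {..<p} k"
    by (rule elem_sym_ge) (auto simp: turan_sizes_def)
  also have "\<dots> \<le> edge_value (turan_sizes n p) p (p - 1) k" by (simp add: edge_value_def)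
  also note edge_value_le_turan_plus[OF assms]
  finally show ?thesis by simp
qed

text \<open>The new vertex \<open>n\<close> is joined to all other residue classes, each with at least \<open>n div p\<close> vertices, and every
transversal \<open>(k - 1)\<close>-clique there gives a new \<open>k\<close>-clique.\<close>

lemma turan_plus_cliques_Suc:
  assumes p: "0 < p" "2 * p \<le> n" and k: "1 \<le> k"
  shows "card (cliques (adj (turan_plus n p)) {..<n} k) + (p - 1 choose (k - 1)) * (n div p) ^ (k - 1)
    \<le> card (cliques (adj (turan_plus (Suc n) p)) {..<Suc n} k)"
proof -
  let ?J = "{..<p} - {n mod p}"
  let ?B = "cliques (\<lambda>u v. u mod p \<noteq> v mod p) {v \<in> {..<n}. v mod p \<in> ?J} (k - 1)"
  let ?A = "cliques (adj (turan_plus n p)) {..<n} k" and ?C = "cliques (adj (turan_plus (Suc n) p)) {..<Suc n} k"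
  have "card ?J = p - 1" using p by simp
  moreover have "(card ?J choose (k - 1)) * (n div p) ^ (k - 1) \<le> elem_sym (turan_sizes n p) ?J (k - 1)"
    by (rule elem_sym_ge) (auto simp: turan_sizes_def)
  ultimately have B: "(p - 1 choose (k - 1)) * (n div p) ^ (k - 1) \<le> card ?B"
    using card_cliques_turan[of ?J p n "k - 1"] by auto
  have nB: "n \<notin> S" "finite S" "card S = k - 1" if "S \<in> ?B" for S
    using that finite_subset[of S "{..<n}"] by (auto simp: cliques_def)
  have inj: "inj_on (insert n) ?B"
  proof (rule inj_onI)
    fix S T assume ST: "S \<in> ?B" "T \<in> ?B" "insert n S = insert n T"
    then show "S = T" using insert_ident[of n S T] nB(1)[OF ST(1)] nB(1)[OF ST(2)] by simp
  qed
  have "?A \<subseteq> ?C" by (rule cliques_mono) (auto simp: adj_turan_plus)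
  moreover have "insert n ` ?B \<subseteq> ?C"
  proof clarify
    fix S assume S: "S \<in> ?B"
    then show "insert n S \<in> ?C" using nB[OF S] k by (auto simp: cliques_def adj_turan_plus)
  qed
  moreover have "?A \<inter> insert n ` ?B = {}" by (auto simp: cliques_def)
  ultimately have "card ?A + card (insert n ` ?B) \<le> card ?C"
    by (intro card_add_le_card finite_cliques finite_lessThan)
  then have "card ?A + card ?B \<le> card ?C" by (simp only: card_image[OF inj])
  then show ?thesis using B by linarith
qed

lemma turan_plus_cliques_add:
  assumes p: "0 < p" "2 * p \<le> n" and k: "1 \<le> k"
  shows "card (cliques (adj (turan_plus n p)) {..<n} k) + s * ((p - 1 choose (k - 1)) * (n div p) ^ (k - 1))
    \<le> card (cliques (adj (turan_plus (n + s) p)) {..<n + s} k)"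
proof (induction s)
  case (Suc s)
  have "(p - 1 choose (k - 1)) * (n div p) ^ (k - 1) \<le> (p - 1 choose (k - 1)) * ((n + s) div p) ^ (k - 1)"
    by (intro mult_le_mono2 power_mono div_le_mono) auto
  moreover have "card (cliques (adj (turan_plus (n + s) p)) {..<n + s} k) + (p - 1 choose (k - 1)) * ((n + s) div p) ^ (k - 1)
    \<le> card (cliques (adj (turan_plus (Suc (n + s)) p)) {..<Suc (n + s)} k)"
    using assms by (intro turan_plus_cliques_Suc) auto
  ultimately have "card (cliques (adj (turan_plus n p)) {..<n} k)
      + s * ((p - 1 choose (k - 1)) * (n div p) ^ (k - 1)) + (p - 1 choose (k - 1)) * (n div p) ^ (k - 1)
    \<le> card (cliques (adj (turan_plus (Suc (n + s)) p)) {..<Suc (n + s)} k)"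
    using Suc by linarith
  then show ?case by (simp only: add_Suc_right mult_Suc add_ac)
qed simp

text \<open>By the pigeonhole principle a clique with \<open>p + 1\<close> vertices uses some residue class twice, hence contains the added
edge; so any two such cliques share both its ends.\<close>

lemma turan_plus_bowtie_free:
  assumes p: "0 < p"
  shows "bowtie_free (adj (turan_plus n p)) {..<n} (Suc p)"
proof -
  have K: "{p - 1, 2 * p - 1} \<subseteq> A" if A: "A \<in> cliques (adj (turan_plus n p)) {..<n} (Suc p)" for A
  proof -
    have "card ((\<lambda>v. v mod p) ` A) \<le> card {..<p}"
      using p by (intro card_mono) auto
    moreover have "card A = Suc p" using A by (simp add: cliques_def)
    ultimately have "\<not> inj_on (\<lambda>v. v mod p) A" using card_image[of "\<lambda>v. v mod p" A] by auto
    then obtain u v where "u \<in> A" "v \<in> A" "u \<noteq> v" "u mod p = v mod p" by (auto simp: inj_on_def)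
    then have "{u, v} = {p - 1, 2 * p - 1}" using A by (auto simp: cliques_def adj_turan_plus)
    then show ?thesis using \<open>u \<in> A\<close> \<open>v \<in> A\<close> by auto
  qed
  have "card (A \<inter> B) \<noteq> 1" if "{p - 1, 2 * p - 1} \<subseteq> A" "{p - 1, 2 * p - 1} \<subseteq> B" for A B :: "nat set"
  proof
    assume "card (A \<inter> B) = 1"
    then obtain x where "A \<inter> B = {x}" by (auto simp: card_1_singleton_iff)
    then have "p - 1 = x" "2 * p - 1 = x" using that by auto
    then show False using p by simp
  qed
  then show ?thesis using K unfolding bowtie_free_def by blast
qed

section \<open>Counting cliques and the extremal theorem\<close>

lemma card_sets_with_point_le:
  assumes "finite V" "Y \<subseteq> V"
  shows "card {S. S \<subseteq> V \<and> card S = m \<and> S \<inter> Y \<noteq> {}} \<le> card Y * card V ^ (m - 1)"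
proof -
  have fY: "finite Y" using assms finite_subset by blast
  have "{S. S \<subseteq> V \<and> card S = m \<and> S \<inter> Y \<noteq> {}} = (\<Union>y\<in>Y. {S. S \<subseteq> V \<and> card S = m \<and> {y} \<subseteq> S})"
    by auto
  also have "card \<dots> \<le> (\<Sum>y\<in>Y. card {S. S \<subseteq> V \<and> card S = m \<and> {y} \<subseteq> S})"
    by (rule card_UN_le[OF fY])
  also have "\<dots> \<le> (\<Sum>y\<in>Y. card V ^ (m - 1))"
    by (intro sum_mono card_supersets_le[OF assms(1)]) auto
  finally show ?thesis by simp
qed

context near_turan
begin

lemma cross_clique_count:
  assumes "U \<subseteq> V" "i < p"
  shows "card (cliques (\<lambda>u v. g u \<noteq> g v) U m) = elem_sym (\<lambda>j. card {v \<in> U. g v = j}) {..<p} m"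
    "card (cliques (\<lambda>u v. g u \<noteq> g v) {v \<in> U. g v \<noteq> i} m) = elem_sym (\<lambda>j. card {v \<in> U. g v = j}) ({..<p} - {i}) m"
proof -
  have fU: "finite U" using assms fin finite_subset by blast
  have "{v \<in> U. g v \<in> {..<p}} = U" "{v \<in> U. g v \<in> {..<p} - {i}} = {v \<in> U. g v \<noteq> i}"
    using assms g by auto
  then show "card (cliques (\<lambda>u v. g u \<noteq> g v) U m) = elem_sym (\<lambda>j. card {v \<in> U. g v = j}) {..<p} m"
    "card (cliques (\<lambda>u v. g u \<noteq> g v) {v \<in> U. g v \<noteq> i} m) = elem_sym (\<lambda>j. card {v \<in> U. g v = j}) ({..<p} - {i}) m"
    using card_multipartite_cliques[OF fU, of "{..<p}" g m] card_multipartite_cliques[OF fU, of "{..<p} - {i}" g m]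
    by simp_all
qed

text \<open>Without inner edges, or with a single one, the count is immediate. A second inner edge forces \<open>p = k = 2\<close> and a
missing cross edge \<open>{x, m}\<close>; as no part then contains a second inner edge, the two inner edges and the missing one
balance to a single extra edge.\<close>

lemma ordinary_clique_count:
  assumes k: "2 \<le> k" "k \<le> p"
  defines "U \<equiv> V - exceptional"
  shows "\<exists>i<p. card (cliques E U k) \<le> edge_value (\<lambda>j. card {v \<in> U. g v = j}) p i k"
proof -
  let ?a = "\<lambda>j. card {v \<in> U. g v = j}" and ?X = "\<lambda>u v. g u \<noteq> g v"
  have U: "U \<subseteq> V" "finite U" using fin by (auto simp: U_def)
  have gp: "g v < p" if "v \<in> U" for v using that U g by auto
  have p0: "0 < p" using k by simp
  show ?thesis
  proof (cases "\<exists>x y. x \<in> U \<and> y \<in> U \<and> E x y \<and> g x = g y")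
    case False
    then have "cliques E U k \<subseteq> cliques ?X U k" by (intro cliques_mono) auto
    then have "card (cliques E U k) \<le> card (cliques ?X U k)"
      by (rule card_mono[OF finite_cliques[OF U(2)]])
    also have "\<dots> = elem_sym ?a {..<p} k" by (rule cross_clique_count(1)[OF U(1) p0])
    finally show ?thesis using p0 by (intro exI[of _ 0]) (auto simp: edge_value_def)
  next
    case True
    then obtain x y where xy: "x \<in> U" "y \<in> U" "E x y" "g x = g y" by blast
    show ?thesis
    proof (cases "\<forall>s t. s \<in> U \<and> t \<in> U \<and> E s t \<and> g s = g t \<longrightarrow> {s, t} = {x, y}")
      case True
      let ?B = "cliques ?X {v \<in> U. g v \<noteq> g x} (k - 2)"
      have "cliques E U k \<subseteq> cliques ?X U k \<union> (\<lambda>S. insert x (insert y S)) ` ?B"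
      proof
        fix S assume S: "S \<in> cliques E U k"
        have SU: "S \<subseteq> U" "card S = k" and SE: "\<And>u v. \<lbrakk>u \<in> S; v \<in> S; u \<noteq> v\<rbrakk> \<Longrightarrow> E u v"
          using S by (auto simp: cliques_def)
        have inner: "{s, t} = {x, y}" if "s \<in> S" "t \<in> S" "s \<noteq> t" "g s = g t" for s t
          using True SE[of s t] that SU by blast
        show "S \<in> cliques ?X U k \<union> (\<lambda>S. insert x (insert y S)) ` ?B"
        proof (cases "S \<in> cliques ?X U k")
          case False
          then obtain u v where uv: "u \<in> S" "v \<in> S" "u \<noteq> v" "g u = g v"
            using SU by (auto simp: cliques_def)
          then have "{u, v} = {x, y}" by (rule inner)
          then have xS: "x \<in> S" "y \<in> S" "x \<noteq> y" using uv by (auto simp: doubleton_eq_iff)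
          have "finite S" using SU U finite_subset by blast
          then have "card (S - {x, y}) = k - 2" using xS SU by (simp add: card_Diff_subset)
          moreover have "g z \<noteq> g x" if "z \<in> S - {x, y}" for z
            using inner[of x z] that xS by (auto simp: doubleton_eq_iff)
          moreover have "g s \<noteq> g t" if "s \<in> S - {x, y}" "t \<in> S - {x, y}" "s \<noteq> t" for s t
            using inner[of s t] that by (auto simp: doubleton_eq_iff)
          ultimately have "S - {x, y} \<in> ?B" using SU by (auto simp: cliques_def)
          moreover have "S = insert x (insert y (S - {x, y}))" using xS by auto
          ultimately show ?thesis by blast
        qed simp
      qed
      moreover have fB: "finite ?B" using U by (intro finite_cliques) auto
      ultimately have "card (cliques E U k) \<le> card (cliques ?X U k \<union> (\<lambda>S. insert x (insert y S)) ` ?B)"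
        using U fB by (intro card_mono finite_UnI finite_imageI) (auto intro: finite_cliques)
      also have "\<dots> \<le> card (cliques ?X U k) + card ((\<lambda>S. insert x (insert y S)) ` ?B)" by (rule card_Un_le)
      also have "\<dots> \<le> card (cliques ?X U k) + card ?B"
        using card_image_le[OF fB] by (intro add_left_mono)
      also have "\<dots> = edge_value ?a p (g x) k"
        using cross_clique_count[OF U(1) gp[OF xy(1)]] by (simp add: edge_value_def)
      finally show ?thesis using gp[OF xy(1)] by blast
    next
      case False
      then obtain c d where cd: "c \<in> U" "d \<in> U" "E c d" "g c = g d" "{x, y} \<noteq> {c, d}" by blast
      have two: "p = 2" "g x \<noteq> g c" "\<not> (E x c \<and> E x d)"
        using two_inner_edges[of x y c d] xy cd unfolding U_def by auto
      then have k2: "k = 2" using k by simp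
      obtain m where m: "m \<in> {c, d}" "\<not> E x m" using two(3) by blast
      have mU: "m \<in> U" "g x \<noteq> g m" "x \<noteq> m" using m cd two(2) by auto
      then have xm: "{x, m} \<in> cliques ?X U 2" using xy by (auto simp: cliques_def)
      have "cliques E U 2 \<subseteq> {{x, y}, {c, d}} \<union> (cliques ?X U 2 - {{x, m}})"
      proof
        fix S assume S: "S \<in> cliques E U 2"
        then obtain s t where st: "S = {s, t}" "s \<noteq> t" by (auto simp: cliques_def card_2_iff)
        then have stU: "s \<in> U" "t \<in> U" "E s t" "E t s" using S by (auto simp: cliques_def)
        show "S \<in> {{x, y}, {c, d}} \<union> (cliques ?X U 2 - {{x, m}})"
        proof (cases "g s = g t")
          case True
          have "S = {x, y} \<or> S = {c, d}"
          proof (rule ccontr)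
            assume "\<not> ?thesis"
            then have ne: "{x, y} \<noteq> {s, t}" "{c, d} \<noteq> {s, t}" using st by auto
            have sub: "{x, y, s, t} \<subseteq> V - exceptional" "{c, d, s, t} \<subseteq> V - exceptional"
              using xy cd stU by (auto simp: U_def)
            have "g x \<noteq> g s" by (rule two_inner_edges(2)[OF sub(1) xy(3,4) stU(3) True ne(1)])
            moreover have "g c \<noteq> g s" by (rule two_inner_edges(2)[OF sub(2) cd(3,4) stU(3) True ne(2)])
            ultimately show False using two gp[OF xy(1)] gp[OF cd(1)] gp[OF stU(1)] by linarith
          qed
          then show ?thesis by auto
        next
          case False
          then have "S \<in> cliques ?X U 2" using st stU by (auto simp: cliques_def)
          moreover have "S \<noteq> {x, m}" using st stU m(2) by (auto simp: doubleton_eq_iff)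
          ultimately show ?thesis by simp
        qed
      qed
      then have "card (cliques E U 2) \<le> card ({{x, y}, {c, d}} \<union> (cliques ?X U 2 - {{x, m}}))"
        using U by (intro card_mono finite_UnI finite_Diff finite_cliques) auto
      also have "\<dots> \<le> card {{x, y}, {c, d}} + card (cliques ?X U 2 - {{x, m}})" by (rule card_Un_le)
      also have "\<dots> \<le> 2 + (card (cliques ?X U 2) - 1)"
        using xm U by (intro add_mono) (auto simp: card_insert_if finite_cliques)
      also have "\<dots> = card (cliques ?X U 2) + 1"
      proof -
        have "card (cliques ?X U 2) > 0" using xm U by (subst card_gt_0_iff) (auto simp: finite_cliques)
        then show ?thesis by simp
      qed
      \<comment> \<open>For \<open>k = 2\<close> the extra edge contributes exactly one, whichever part it lies in.\<close>
      also have "\<dots> = edge_value ?a p 0 k"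
        using cross_clique_count(1)[OF U(1) p0] k2 by (simp add: edge_value_def elem_sym_0)
      finally show ?thesis using p0 k2 by blast
    qed
  qed
qed

text \<open>The \<open>k\<close>-cliques through \<open>w\<close> correspond to \<open>(k - 1)\<close>-cliques in its neighbourhood. By \<open>inner_degree\<close>, those that contain
a vertex of the part of \<open>w\<close> or an inner edge are few. The others live in a \<open>(p - 1)\<close>-partite graph on \<open>X\<close>, the
neighbours of \<open>w\<close> in other parts, and \<open>clique_count_le\<close> bounds their number in terms of the reduced size of \<open>X\<close>.\<close>

lemma exceptional_degree:
  assumes w: "w \<in> exceptional" and k: "2 \<le> k" "k \<le> p"
  shows "card {S \<in> cliques E V k. w \<in> S} \<le>
    ((p - 1 choose (k - 1)) * ((1 - 1 / p + \<epsilon> - 1 / (8 * real p)) / real (p - 1)) ^ (k - 1) + 2 * ((real p + 3) * \<epsilon>)) * n ^ (k - 1)"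
proof -
  have wV: "w \<in> V" using w by (simp add: exceptional_def)
  have gw: "g w < p" using wV g by auto
  define X where "X = {u \<in> V. E w u \<and> g w \<noteq> g u}"
  define Y where "Y = {u \<in> V. E w u \<and> g u = g w}"
  define H where "H u v \<longleftrightarrow> E u v \<and> g u \<noteq> g v" for u v
  define D where "D = {(u, v). u \<in> V \<and> v \<in> V \<and> E u v \<and> g u = g v}"
  define \<tau> where "\<tau> = (real p + 3) * \<epsilon>"
  let ?P = "{S. S \<subseteq> V \<and> card S = k - 1 \<and> S \<inter> Y \<noteq> {}}"
  let ?Q = "{S. S \<subseteq> V \<and> card S = k - 1 \<and> (\<exists>(u, v)\<in>D. u \<noteq> v \<and> u \<in> S \<and> v \<in> S)}"
  have fX: "finite X" using fin by (simp add: X_def)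
  have "inj_on (\<lambda>S. S - {w}) {S \<in> cliques E V k. w \<in> S}" by (rule inj_onI) blast
  moreover have "(\<lambda>S. S - {w}) ` {S \<in> cliques E V k. w \<in> S} \<subseteq> cliques H X (k - 1) \<union> ?P \<union> ?Q"
  proof (rule image_subsetI)
    fix S assume "S \<in> {S \<in> cliques E V k. w \<in> S}"
    then have S: "S \<in> cliques E V k" "w \<in> S" by auto
    have "S - {w} \<in> cliques H X (k - 1)" if S3: "S - {w} \<notin> ?Q" and S4: "S - {w} \<notin> ?P"
    proof -
    have SV: "S \<subseteq> V" "card S = k" and SE: "\<And>u v. \<lbrakk>u \<in> S; v \<in> S; u \<noteq> v\<rbrakk> \<Longrightarrow> E u v"
      using S by (auto simp: cliques_def)
    have c: "card (S - {w}) = k - 1" "S - {w} \<subseteq> V" using SV S(2) by auto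
    have "g w \<noteq> g u" if u: "u \<in> S - {w}" for u
    proof
      assume "g w = g u"
      then have "u \<in> Y" using u SV SE[of w u] S(2) by (auto simp: Y_def)
      then show False using S4 c u by blast
    qed
    then have "S - {w} \<subseteq> X" using SV SE[OF S(2)] by (auto simp: X_def)
    moreover have "H u v" if uv: "u \<in> S - {w}" "v \<in> S - {w}" "u \<noteq> v" for u v
    proof -
      have "E u v" using SE uv by auto
      moreover have "g u \<noteq> g v"
      proof
        assume "g u = g v"
        then have "(u, v) \<in> D" using uv SV \<open>E u v\<close> by (auto simp: D_def)
        then show False using S3 c uv by blast
      qed
      ultimately show ?thesis by (simp add: H_def)
    qed
    ultimately show ?thesis using c by (auto simp: cliques_def)
    qed
    then show "S - {w} \<in> cliques H X (k - 1) \<union> ?P \<union> ?Q" by blast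
  qed
  moreover have "finite (cliques H X (k - 1) \<union> ?P \<union> ?Q)" using fin fX by (auto intro: finite_cliques)
  ultimately have "card {S \<in> cliques E V k. w \<in> S} \<le> card (cliques H X (k - 1) \<union> ?P \<union> ?Q)"
    by (rule card_inj_on_le)
  also have "\<dots> \<le> card (cliques H X (k - 1)) + card ?P + card ?Q"
    by (meson card_Un_le add_le_mono le_trans order_refl)
  finally have "real (card {S \<in> cliques E V k. w \<in> S}) \<le> real (card (cliques H X (k - 1)) + card ?P + card ?Q)"
    by (simp only: of_nat_le_iff)
  moreover have "real (card (cliques H X (k - 1))) \<le>
    (p - 1 choose (k - 1)) * ((1 - 1 / p + \<epsilon> - 1 / (8 * real p)) / real (p - 1)) ^ (k - 1) * n ^ (k - 1)"
  proof -
    have "cliques H X (Suc (p - 1)) = {}"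
    proof (rule ccontr)
      assume "cliques H X (Suc (p - 1)) \<noteq> {}"
      then obtain S where S: "S \<subseteq> X" "card S = Suc (p - 1)" "\<And>u v. \<lbrakk>u \<in> S; v \<in> S; u \<noteq> v\<rbrakk> \<Longrightarrow> g u \<noteq> g v"
        by (auto simp: cliques_def H_def)
      have "inj_on g S" using S(3) by (meson inj_onI)
      moreover have "g ` S \<subseteq> {..<p} - {g w}" using S(1) g by (auto simp: X_def)
      ultimately have "card S \<le> card ({..<p} - {g w})" by (intro card_inj_on_le) auto
      then show False using S(2) gw by simp
    qed
    moreover have "H u v \<longleftrightarrow> H v u" for u v using sym by (auto simp: H_def)
    ultimately have "real (p - 1 choose 0) * card (cliques H X (0 + (k - 1))) \<le>
      real (p - 1 choose (0 + (k - 1))) * (card X / real (p - 1)) ^ (k - 1) * card (cliques H X 0)"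
      using k by (intro clique_count_le[OF fX]) auto
    then have 1: "real (card (cliques H X (k - 1))) \<le> real (p - 1 choose (k - 1)) * (card X / real (p - 1)) ^ (k - 1)"
      using card_cliques_0[OF fX] by simp
    have "real (card X) \<le> (1 - 1 / p + \<epsilon> - 1 / (8 * real p)) * n"
    proof -
      have "card X + card (missing w) + card {v \<in> V. g v = g w} \<le> card V"
      proof -
        have "card (X \<union> missing w \<union> {v \<in> V. g v = g w}) \<le> card V"
          by (rule card_mono[OF fin]) (auto simp: X_def missing_def)
        moreover have "card (X \<union> missing w \<union> {v \<in> V. g v = g w}) = card X + card (missing w) + card {v \<in> V. g v = g w}"
          by (subst card_Un_disjoint, use fin finite_missing fX in \<open>auto simp: X_def missing_def\<close>)
            (subst card_Un_disjoint, use fin finite_missing fX in \<open>auto simp: X_def missing_def\<close>)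
        ultimately show ?thesis by simp
      qed
      then have "real (card X) + card (missing w) + card {v \<in> V. g v = g w} \<le> n"
        by (simp flip: of_nat_add)
      moreover have "n / (8 * p) < card (missing w)" using w by (simp add: exceptional_def)
      moreover have "n / p - \<epsilon> * n \<le> card {v \<in> V. g v = g w}" using part_size[OF gw] by linarith
      ultimately have "real (card X) \<le> n - n / p + \<epsilon> * n - n / (8 * p)" by linarith
      then show ?thesis by (simp add: algebra_simps)
    qed
    then have "card X / real (p - 1) \<le> (1 - 1 / p + \<epsilon> - 1 / (8 * real p)) / real (p - 1) * n"
      using p by (simp add: divide_right_mono)
    then have "(card X / real (p - 1)) ^ (k - 1) \<le> ((1 - 1 / p + \<epsilon> - 1 / (8 * real p)) / real (p - 1) * n) ^ (k - 1)"
      by (intro power_mono) auto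
    then have "real (p - 1 choose (k - 1)) * (card X / real (p - 1)) ^ (k - 1) \<le>
      real (p - 1 choose (k - 1)) * ((1 - 1 / p + \<epsilon> - 1 / (8 * real p)) / real (p - 1) * n) ^ (k - 1)"
      by (intro mult_left_mono) auto
    then show ?thesis using 1 by (simp only: power_mult_distrib mult.assoc)
  qed
  moreover have "real (card ?P) \<le> \<tau> * n ^ (k - 1)"
  proof -
    have "card ?P \<le> card Y * card V ^ (k - 1 - 1)"
      by (rule card_sets_with_point_le[OF fin]) (auto simp: Y_def)
    then have "real (card ?P) \<le> real (card Y * card V ^ (k - 1 - 1))" by (simp only: of_nat_le_iff)
    also have "\<dots> = card Y * n ^ (k - 1 - 1)" by simp
    also have "\<dots> \<le> (\<tau> * n) * n ^ (k - 1 - 1)"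
      using inner_degree[OF wV] by (intro mult_right_mono) (auto simp: Y_def \<tau>_def)
    also have "\<dots> = \<tau> * n ^ Suc (k - 1 - 1)" by simp
    also have "Suc (k - 1 - 1) = k - 1" using k by simp
    finally show ?thesis .
  qed
  moreover have "real (card ?Q) \<le> \<tau> * n ^ (k - 1)"
  proof (cases "k = 2")
    case True
    have "?Q = {}"
    proof (rule ccontr)
      assume "?Q \<noteq> {}"
      then obtain S where S: "card S = 1" "\<exists>(u, v)\<in>D. u \<noteq> v \<and> u \<in> S \<and> v \<in> S" using True by auto
      obtain x where "S = {x}" using S(1) by (auto simp: card_1_singleton_iff)
      then show False using S(2) by auto
    qed
    then have "card ?Q = 0" by (simp only: card.empty)
    then show ?thesis using eps by (simp only: \<tau>_def) simp
  next
    case False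
    have "card ?Q \<le> card D * card V ^ (k - 1 - 2)"
      by (rule card_sets_with_pair_le[OF fin]) (auto simp: D_def)
    then have "real (card ?Q) \<le> real (card D * card V ^ (k - 1 - 2))" by (simp only: of_nat_le_iff)
    also have "\<dots> = card D * n ^ (k - 1 - 2)" by simp
    also have "\<dots> \<le> (\<tau> * n * n) * n ^ (k - 1 - 2)"
    proof (intro mult_right_mono)
      have "card D = npairs (\<lambda>u v. E u v \<and> g v = g u) V V"
        unfolding D_def npairs_eq_card[OF fin fin] by (intro arg_cong[of _ _ card]) auto
      then have "real (card D) = (\<Sum>v\<in>V. real (card {u \<in> V. E v u \<and> g u = g v}))"
        by (simp add: npairs_def)
      also have "\<dots> \<le> (\<Sum>v\<in>V. \<tau> * n)"
        using inner_degree by (intro sum_mono) (auto simp: \<tau>_def)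
      finally show "real (card D) \<le> \<tau> * n * n" by (simp add: mult_ac)
    qed simp
    also have "\<dots> = \<tau> * n ^ Suc (Suc (k - 1 - 2))" by simp
    also have "Suc (Suc (k - 1 - 2)) = k - 1" using k False by simp
    finally show ?thesis .
  qed
  ultimately have "real (card {S \<in> cliques E V k. w \<in> S}) \<le>
    (p - 1 choose (k - 1)) * ((1 - 1 / p + \<epsilon> - 1 / (8 * real p)) / real (p - 1)) ^ (k - 1) * n ^ (k - 1)
      + \<tau> * n ^ (k - 1) + \<tau> * n ^ (k - 1)"
    unfolding of_nat_add by linarith
  then show ?thesis unfolding \<tau>_def[symmetric] distrib_right[of _ _ "n ^ (k - 1)"] mult_2 by simp
qed

text \<open>The hypothesis \<open>gap\<close> says that an exceptional vertex lies in at most as many \<open>k\<close>-cliques as the Turan graph gains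
with each new vertex; the latter is \<open>turan_plus_cliques_add\<close>. So the bound for the graph without its exceptional vertices
carries over to the whole graph.\<close>

theorem clique_count_le_turan_plus:
  assumes k: "2 \<le> k" "k \<le> p"
    and gap: "(p - 1 choose (k - 1)) * ((1 - 1 / p + \<epsilon> - 1 / (8 * real p)) / real (p - 1)) ^ (k - 1) + 2 * ((real p + 3) * \<epsilon>)
      \<le> (p - 1 choose (k - 1)) * (1 / p - 2 * \<epsilon>) ^ (k - 1)"
  shows "card (cliques E V k) \<le> card (cliques (adj (turan_plus (card V) p)) {..<card V} k)"
proof -
  define U where "U = V - exceptional"
  define a where "a j = card {v \<in> U. g v = j}" for j
  define c where "c = real (p - 1 choose (k - 1))"
  define s where "s = card exceptional"
  have p0: "0 < p" using p by simp
  have U: "U \<subseteq> V" "finite U" using fin by (auto simp: U_def)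
  have fe: "finite exceptional" using fin exceptional_subset finite_subset by blast
  have cU: "card V = card U + s"
    unfolding U_def s_def using card_Diff_subset[OF fe exceptional_subset] card_mono[OF fin exceptional_subset] by simp
  have s: "real s \<le> \<epsilon> * n" unfolding s_def by (rule card_exceptional)
  have en: "real k \<le> \<epsilon> * n" "1 \<le> \<epsilon> * n" using large k by linarith+
  have a_ge: "k \<le> a j" if "j < p" for j
  proof -
    have "card {v \<in> V. g v = j} \<le> a j + s"
    proof -
      have "{v \<in> V. g v = j} \<subseteq> {v \<in> U. g v = j} \<union> exceptional" by (auto simp: U_def)
      then have "card {v \<in> V. g v = j} \<le> card ({v \<in> U. g v = j} \<union> exceptional)"
        using U fe by (intro card_mono) auto
      also have "\<dots> \<le> a j + s" unfolding a_def s_def by (rule card_Un_le)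
      finally show ?thesis .
    qed
    then have "n / p - \<epsilon> * n \<le> a j + \<epsilon> * n" using part_size[OF that] s by linarith
    moreover have "3 * (\<epsilon> * n) \<le> n / p"
    proof -
      have "3 * (\<epsilon> * n) \<le> 3 * (n / (8 * real p * real p))" using eps_small by simp
      also have "\<dots> \<le> n / p" using p n_pos by (simp add: field_simps)
      finally show ?thesis .
    qed
    ultimately have "real k \<le> a j" using en by linarith
    then show ?thesis by simp
  qed
  have sum_a: "sum a {..<p} = card U"
    unfolding a_def using g U by (intro sum_card_parts) auto
  have "(\<Sum>j<p. k) \<le> sum a {..<p}" using a_ge by (intro sum_mono) auto
  then have "p * k \<le> card U" using sum_a by simp
  moreover have "p * 2 \<le> p * k" by (rule mult_le_mono2[OF k(1)])
  ultimately have U2: "2 * p \<le> card U" by linarith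
  obtain i where i: "i < p" "card (cliques E U k) \<le> edge_value a p i k"
    using ordinary_clique_count[OF k] unfolding U_def a_def by blast
  note i(2)
  also have "edge_value a p i k \<le> edge_value (turan_sizes (card U) p) p (p - 1) k"
    using edge_value_le_turan[of k p a i, OF k a_ge i(1)] sum_a by simp
  also have "\<dots> \<le> card (cliques (adj (turan_plus (card U) p)) {..<card U} k)"
    by (rule edge_value_le_turan_plus[OF p0 U2 k(1)])
  finally have 1: "card (cliques E U k) \<le> card (cliques (adj (turan_plus (card U) p)) {..<card U} k)" .
  have 2: "card (cliques (adj (turan_plus (card U) p)) {..<card U} k)
      + s * ((p - 1 choose (k - 1)) * (card U div p) ^ (k - 1))
    \<le> card (cliques (adj (turan_plus (card V) p)) {..<card V} k)"
    unfolding cU using k by (intro turan_plus_cliques_add[OF p0 U2]) simp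
  have "cliques E V k \<subseteq> cliques E U k \<union> (\<Union>w\<in>exceptional. {S \<in> cliques E V k. w \<in> S})"
    by (auto simp: cliques_def U_def)
  then have "card (cliques E V k) \<le> card (cliques E U k \<union> (\<Union>w\<in>exceptional. {S \<in> cliques E V k. w \<in> S}))"
  proof (rule card_mono[rotated])
    have "finite {S \<in> cliques E V k. w \<in> S}" for w
      by (rule finite_subset[OF _ finite_cliques[OF fin, of E k]]) auto
    then show "finite (cliques E U k \<union> (\<Union>w\<in>exceptional. {S \<in> cliques E V k. w \<in> S}))"
      using fe U by (auto intro: finite_cliques)
  qed
  also have "\<dots> \<le> card (cliques E U k) + card (\<Union>w\<in>exceptional. {S \<in> cliques E V k. w \<in> S})"
    by (rule card_Un_le)
  also have "\<dots> \<le> card (cliques E U k) + (\<Sum>w\<in>exceptional. card {S \<in> cliques E V k. w \<in> S})"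
    by (intro add_left_mono card_UN_le[OF fe])
  finally have "real (card (cliques E V k)) \<le> real (card (cliques E U k) + (\<Sum>w\<in>exceptional. card {S \<in> cliques E V k. w \<in> S}))"
    by (simp only: of_nat_le_iff)
  moreover have "(\<Sum>w\<in>exceptional. real (card {S \<in> cliques E V k. w \<in> S})) \<le> s * (c * real (card U div p) ^ (k - 1))"
  proof -
    have "(1 / p - 2 * \<epsilon>) * n \<le> real (card U div p)"
    proof -
      have "card U \<le> card U div p * p + p"
      proof -
        have "card U = card U div p * p + card U mod p" by simp
        also have "\<dots> \<le> card U div p * p + p" using p0 by (intro add_left_mono) (simp add: less_imp_le)
        finally show ?thesis .
      qed
      then have "real (card U) \<le> real (card U div p * p + p)" by (simp only: of_nat_le_iff)
      then have "real (card U) / p \<le> real (card U div p) + 1" using p0 by (simp add: field_simps)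
      moreover have "n / p - \<epsilon> * n \<le> real (card U) / p"
      proof -
        have "n - \<epsilon> * n \<le> real (card U)" using cU s by linarith
        then have "(n - \<epsilon> * n) / p \<le> real (card U) / p" using p0 by (intro divide_right_mono) auto
        moreover have "\<epsilon> * n / p \<le> \<epsilon> * n"
        proof -
          have "\<epsilon> * n * 1 \<le> \<epsilon> * n * p" using en p0 by (intro mult_left_mono) auto
          then show ?thesis using p0 by (simp add: field_simps)
        qed
        ultimately show ?thesis by (simp add: diff_divide_distrib)
      qed
      ultimately have "n / p - 2 * (\<epsilon> * n) \<le> real (card U div p)" using en by linarith
      then show ?thesis by (simp add: algebra_simps)
    qed
    moreover have "0 \<le> (1 / p - 2 * \<epsilon>) * n"
    proof -
      have "2 * (\<epsilon> * n) \<le> 2 * (n / (8 * real p * real p))" using eps_small by simp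
      also have "\<dots> \<le> n / p" using p n_pos by (simp add: field_simps)
      finally show ?thesis by (simp add: algebra_simps)
    qed
    ultimately have *: "(1 / p - 2 * \<epsilon>) ^ (k - 1) * n ^ (k - 1) \<le> real (card U div p) ^ (k - 1)"
      unfolding power_mult_distrib[symmetric] by (rule power_mono)
    have "real (card {S \<in> cliques E V k. w \<in> S}) \<le> c * real (card U div p) ^ (k - 1)" if "w \<in> exceptional" for w
    proof -
      have "real (card {S \<in> cliques E V k. w \<in> S}) \<le> c * (1 / p - 2 * \<epsilon>) ^ (k - 1) * n ^ (k - 1)"
        using exceptional_degree[OF that k] mult_right_mono[OF gap, of "n ^ (k - 1)"] unfolding c_def by simp
      also have "\<dots> \<le> c * real (card U div p) ^ (k - 1)"
        using mult_left_mono[OF *, of c] by (simp add: c_def mult_ac)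
      finally show ?thesis .
    qed
    then have "(\<Sum>w\<in>exceptional. real (card {S \<in> cliques E V k. w \<in> S})) \<le> (\<Sum>w\<in>exceptional. c * real (card U div p) ^ (k - 1))"
      by (rule sum_mono)
    then show ?thesis by (simp add: s_def)
  qed
  ultimately have "real (card (cliques E V k)) \<le> real (card (cliques E U k)) + s * (c * real (card U div p) ^ (k - 1))"
    by simp
  also have "\<dots> = real (card (cliques E U k) + s * ((p - 1 choose (k - 1)) * (card U div p) ^ (k - 1)))"
    by (simp add: c_def)
  finally have "card (cliques E V k) \<le> card (cliques E U k) + s * ((p - 1 choose (k - 1)) * (card U div p) ^ (k - 1))"
    by (simp only: of_nat_le_iff)
  then show ?thesis using 1 2 by linarith
qed

end

text \<open>At \<open>\<epsilon> = 0\<close> the second inequality is strict, because an exceptional vertex misses a positive fraction of its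
neighbours; by continuity it persists for small positive \<open>\<epsilon>\<close>.\<close>

lemma exists_threshold:
  assumes k: "2 \<le> k" "k \<le> p"
  shows "\<exists>\<epsilon>>0. 8 * real p * real p * \<epsilon> \<le> 1 \<and>
    (p - 1 choose (k - 1)) * ((1 - 1 / p + \<epsilon> - 1 / (8 * real p)) / real (p - 1)) ^ (k - 1) + 2 * ((real p + 3) * \<epsilon>)
      \<le> (p - 1 choose (k - 1)) * (1 / p - 2 * \<epsilon>) ^ (k - 1)"
proof -
  define c where "c = real (p - 1 choose (k - 1))"
  define f where "f \<epsilon> = c * ((1 - 1 / p + \<epsilon> - 1 / (8 * real p)) / real (p - 1)) ^ (k - 1) + 2 * ((real p + 3) * \<epsilon>)" for \<epsilon>
  define h where "h \<epsilon> = c * (1 / p - 2 * \<epsilon>) ^ (k - 1)" for \<epsilon>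
  have p2: "2 \<le> p" using k by simp
  have c: "c > 0" using k by (simp add: c_def)
  have "(1 - 1 / p - 1 / (8 * real p)) / real (p - 1) < 1 / p"
  proof -
    have "(1 - 1 / p - 1 / (8 * real p)) / real (p - 1) < (1 - 1 / p) / real (p - 1)"
      using p2 by (intro divide_strict_right_mono) (auto simp: field_simps)
    also have "\<dots> = 1 / p" using p2 by (simp add: field_simps of_nat_diff)
    finally show ?thesis .
  qed
  moreover have "0 \<le> (1 - 1 / p - 1 / (8 * real p)) / real (p - 1)"
    using p2 by (simp add: field_simps)
  ultimately have "((1 - 1 / p - 1 / (8 * real p)) / real (p - 1)) ^ (k - 1) < (1 / p) ^ (k - 1)"
    using k by (intro power_strict_mono) auto
  then have "f 0 < h 0" using c by (simp add: f_def h_def)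
  have "((\<lambda>\<epsilon>. h \<epsilon> - f \<epsilon>) \<longlongrightarrow> h 0 - f 0) (at_right 0)"
    unfolding f_def h_def using p2 by (intro tendsto_intros) auto
  then have "\<forall>\<^sub>F \<epsilon> in at_right 0. 0 < h \<epsilon> - f \<epsilon>"
    using \<open>f 0 < h 0\<close> by (intro order_tendstoD(1)) auto
  moreover have "((\<lambda>\<epsilon>. 8 * real p * real p * \<epsilon>) \<longlongrightarrow> 8 * real p * real p * 0) (at_right 0)"
    by (intro tendsto_intros)
  then have "\<forall>\<^sub>F \<epsilon> in at_right 0. 8 * real p * real p * \<epsilon> < 1"
    by (intro order_tendstoD(2)) auto
  moreover have "\<forall>\<^sub>F \<epsilon> in at_right (0::real). 0 < \<epsilon>" by (rule eventually_at_right_less)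
  ultimately have "\<forall>\<^sub>F \<epsilon> in at_right 0. 0 < \<epsilon> \<and> 8 * real p * real p * \<epsilon> \<le> 1 \<and> f \<epsilon> \<le> h \<epsilon>"
    by eventually_elim auto
  then obtain \<epsilon> where "0 < \<epsilon> \<and> 8 * real p * real p * \<epsilon> \<le> 1 \<and> f \<epsilon> \<le> h \<epsilon>"
    using eventually_happens'[OF trivial_limit_at_right_real] by blast
  then show ?thesis unfolding f_def h_def c_def by (rule exI)
qed

text \<open>A graph with fewer \<open>k\<close>-cliques than the balanced complete \<open>p\<close>-partite part of \<open>T\<^sup>+\<close> satisfies the bound trivially;
every other graph has a cut as in \<open>near_turan\<close>.\<close>

theorem bowtie_free_clique_count:
  assumes k: "2 \<le> k" "k \<le> p"
  shows "\<forall>\<^sub>F n in sequentially. \<forall>(V :: 'a set) E. finite V \<and> card V = n \<and> (\<forall>u v. E u v \<longleftrightarrow> E v u) \<and> (\<forall>u. \<not> E u u)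
    \<and> bowtie_free E V (Suc p) \<longrightarrow> card (cliques E V k) \<le> card (cliques (adj (turan_plus n p)) {..<n} k)"
proof -
  obtain \<epsilon> where eps: "0 < \<epsilon>" "8 * real p * real p * \<epsilon> \<le> 1"
    and gap: "(p - 1 choose (k - 1)) * ((1 - 1 / p + \<epsilon> - 1 / (8 * real p)) / real (p - 1)) ^ (k - 1) + 2 * ((real p + 3) * \<epsilon>)
      \<le> (p - 1 choose (k - 1)) * (1 / p - 2 * \<epsilon>) ^ (k - 1)"
    using exists_threshold[OF k] by blast
  have "0 < \<epsilon>\<^sup>2" using eps by simp
  note cut = clique_rich_max_cut[OF k this, where 'a = 'a]
  have "\<forall>\<^sub>F n in sequentially. (3 * real p + 8) / \<epsilon> \<le> real n"
    using filterlim_real_sequentially by (simp add: filterlim_at_top)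
  with cut show ?thesis using eventually_ge_at_top[of "2 * p"]
  proof eventually_elim
    case (elim n)
    show ?case
    proof (intro allI impI, elim conjE)
      fix V :: "'a set" and E
      assume fin: "finite V" and n: "card V = n" and sym: "\<forall>u v. E u v \<longleftrightarrow> E v u" and irr: "\<forall>u. \<not> E u u"
        and bf: "bowtie_free E V (Suc p)"
      show "card (cliques E V k) \<le> card (cliques (adj (turan_plus n p)) {..<n} k)"
      proof (cases "(p choose k) * (n div p) ^ k \<le> card (cliques E V k)")
        case False
        moreover have "(p choose k) * (n div p) ^ k \<le> card (cliques (adj (turan_plus n p)) {..<n} k)"
          using elim k by (intro turan_plus_cliques_ge) auto
        ultimately show ?thesis by linarith
      next
        case True
        then have "finite V \<and> card V = n \<and> (\<forall>u v. E u v \<longleftrightarrow> E v u) \<and> (\<forall>u. \<not> E u u) \<and>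
          bowtie_free E V (Suc p) \<and> (p choose k) * (n div p) ^ k \<le> card (cliques E V k)"
          using fin n sym irr bf by (intro conjI)
        from elim(1)[THEN spec, THEN spec, THEN mp, OF this] obtain g where g: "g ` V \<subseteq> {..<p}"
          "(1 - 1 / p - \<epsilon>\<^sup>2) * (real n)\<^sup>2 \<le> npairs (\<lambda>u v. E u v \<and> g u \<noteq> g v) V V"
          "\<forall>v\<in>V. \<forall>j<p. card {u \<in> V. E v u \<and> g u = g v} \<le> card {u \<in> V. E v u \<and> g u = j}"
          by (elim exE conjE)
        interpret near_turan V E p g \<epsilon>
        proof
          show "3 * real p + 8 \<le> \<epsilon> * card V" using elim(2) eps n by (simp add: field_simps)
        qed (use fin sym irr bf k g eps n in auto)
        show ?thesis using clique_count_le_turan_plus[OF k gap] n by simp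
      qed
    qed
  qed
qed

theorem theorem1p3:
  fixes k r :: nat
  assumes "1 \<le> k" and "k < r"
  shows "\<exists>n0. \<forall>n\<ge>n0. ex_num n (complete_graph k) (B1_graph r)
           = num_copies (complete_graph k) (turan_plus n (r - 1))"
proof -
  define p where "p = r - 1"
  have r: "r = Suc p" and p: "1 \<le> p" "k \<le> p" using assms by (auto simp: p_def)
  have "\<forall>\<^sub>F n in sequentially. \<forall>(V :: nat set) E. finite V \<and> card V = n \<and> (\<forall>u v. E u v \<longleftrightarrow> E v u) \<and> (\<forall>u. \<not> E u u)
    \<and> bowtie_free E V (Suc p) \<longrightarrow> card (cliques E V k) \<le> card (cliques (adj (turan_plus n p)) {..<n} k)"
  proof (cases "k = 1")
    case True
    then show ?thesis by (simp add: card_cliques_1[unfolded One_nat_def])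
  next
    case False
    then show ?thesis using assms(1) p by (intro bowtie_free_clique_count) auto
  qed
  then have "\<forall>\<^sub>F n in sequentially. ex_num n (complete_graph k) (B1_graph r)
      = num_copies (complete_graph k) (turan_plus n (r - 1))"
    using eventually_ge_at_top[of "2 * p"]
  proof eventually_elim
    case (elim n)
    let ?T = "turan_plus n p"
    have T: "simple_graph ?T" "verts ?T = {..<n}"
      using simple_graph_turan_plus[OF p(1) elim(2)] by (simp_all add: verts_turan_plus)
    have T_free: "free_of (B1_graph r) ?T"
      using free_of_if_bowtie_free[OF T(1), of r] turan_plus_bowtie_free[of p n] T(2) p r by simp
    have "ex_num n (complete_graph k) (B1_graph r) = num_copies (complete_graph k) ?T"
      unfolding ex_num_def
    proof (rule Max_eqI[OF finite_ex_values])
      show "num_copies (complete_graph k) ?T \<in> ex_values n (complete_graph k) (B1_graph r)"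
        unfolding ex_values_def mem_Collect_eq
        by (intro exI[of _ ?T] conjI refl T(1) T_free) (simp add: T(2))
    next
      fix y assume "y \<in> ex_values n (complete_graph k) (B1_graph r)"
      then obtain G :: "nat graph" where G: "y = num_copies (complete_graph k) G" "simple_graph G"
        "card (verts G) = n" "free_of (B1_graph r) G"
        unfolding ex_values_def by blast
      have "bowtie_free (adj G) (verts G) (Suc p)"
        using bowtie_free_if_free_of[OF G(2) _ G(4)] r by simp
      moreover have "finite (verts G)" using G(2) by (simp add: simple_graph_def)
      moreover have "\<forall>u v. adj G u v \<longleftrightarrow> adj G v u" by (simp add: insert_commute)
      moreover have "\<forall>u. \<not> adj G u u" using adj_irrefl[OF G(2)] by blast
      ultimately have "card (cliques (adj G) (verts G) k) \<le> card (cliques (adj ?T) {..<n} k)"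
        using G(3) by (intro elim(1)[THEN spec, THEN spec, THEN mp] conjI)
      then show "y \<le> num_copies (complete_graph k) ?T"
        using G(1,2) T by (simp add: num_copies_complete_graph)
    qed
    then show ?case by (simp add: p_def)
  qed
  then show ?thesis by (simp add: eventually_sequentially)
qed

end
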